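(* Fix $\delta\in(0,1/4)$ and $\epsilon_{\max}\in(0,1/2)$, and assume that $\sigma^2>0$ is known. There is a constant $c>0$ depending only on $\delta$ and $\epsilon_{\max}$ such that the following holds. For any confidence interval $\widehat{\mathrm{CI}}$ (computed from $n$ i.i.d. observations, possibly using $\sigma$ but not $\varepsilon$) and any function $r(n,\sigma,\varepsilon)$ that satisfy $$\inf_{\theta\in\mathbb R}\ \inf_{\varepsilon\in[0,\epsilon_{\max}],\,Q}P^n_{\theta,\sigma,\varepsilon,Q}\big(\theta\in\widehat{\mathrm{CI}}\big)\ge1-\delta,\qquad \inf_{\theta\in\mathbb R}\ \inf_{\varepsilon\in[0,\epsilon_{\max}],\,Q}P^n_{\theta,\sigma,\varepsilon,Q}\big(|\widehat{\mathrm{CI}}|\le r(n,\sigma,\varepsilon)\big)\ge1-\delta,$$ it must hold that $$r(n,\sigma,\varepsilon)\ \ge\ c\,\sigma\left(\frac1{n^{1/4}}+\frac{\varepsilon^{1/2}}{\sqrt{1\vee\log(en\varepsilon^2)}}\right)$$ for all $(n,\sigma,\varepsilon)$ with $\varepsilon\in[0,\epsilon_{\max}]$.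
   Context: Notation. $a\vee b=\max\{a,b\}$; for $\varepsilon=0$ the term $\varepsilon^{1/2}/\sqrt{1\vee\log(en\varepsilon^2)}$ is $0$. For $I\subseteq\mathbb R$, $|I|=\sup I-\inf I$ denotes its diameter (length). Model (Efron's Gaussian two-groups model). For $\theta\in\mathbb R$, $\sigma>0$, $\varepsilon\in[0,1/2)$ and $Q$ an arbitrary probability distribution on $\mathbb R$, $$P_{\theta,\sigma,\varepsilon,Q}=(1-\varepsilon)\,\mathcal N(\theta,\sigma^2)+\varepsilon\, Q*\mathcal N(0,\sigma^2),$$ and $P^n_{\theta,\sigma,\varepsilon,Q}$ is the law of i.i.d. $X_1,\dots,X_n\sim P_{\theta,\sigma,\varepsilon,Q}$. Infima over $Q$ range over all probability distributions on $\mathbb R$. *)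

theory Defs
  imports "HOL-Probability.Probability"
begin

abbreviation normal_measure :: "real \<Rightarrow> real \<Rightarrow> real measure" where
  "normal_measure \<theta> \<sigma> \<equiv> density lborel (normal_density \<theta> \<sigma>)"

definition two_groups :: "real \<Rightarrow> real \<Rightarrow> real \<Rightarrow> real measure \<Rightarrow> real measure" where
  "two_groups \<theta> \<sigma> \<epsilon> Q = measure_of UNIV (sets borel)
     (\<lambda>A. ennreal (1 - \<epsilon>) * emeasure (normal_measure \<theta> \<sigma>) A
        + ennreal \<epsilon> * emeasure (Q \<star> normal_measure 0 \<sigma>) A)"

definition two_groups_iid :: "nat \<Rightarrow> real \<Rightarrow> real \<Rightarrow> real \<Rightarrow> real measure \<Rightarrow> (nat \<Rightarrow> real) measure" where
  "two_groups_iid n \<theta> \<sigma> \<epsilon> Q = (\<Pi>\<^sub>M i\<in>{..<n}. two_groups \<theta> \<sigma> \<epsilon> Q)"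

text \<open>The length is extended-real valued: it is \<open>\<infinity>\<close> for unbounded sets, and \<open>-\<infinity>\<close> for the
  empty set, so that an empty interval counts as having length at most any given real.\<close>

definition set_length :: "real set \<Rightarrow> ereal" where
  "set_length I = (SUP x\<in>I. ereal x) - (INF x\<in>I. ereal x)"

text \<open>A confidence interval is an arbitrary (open, closed, half-open, empty or unbounded) interval
  depending on the data, for which the coverage and length events are measurable.\<close>

definition confidence_interval :: "nat \<Rightarrow> ((nat \<Rightarrow> real) \<Rightarrow> real set) \<Rightarrow> bool" where
  "confidence_interval n CI \<longleftrightarrow>
     (let M = \<Pi>\<^sub>M i\<in>{..<n}. borel in
       (\<forall>x\<in>space M. is_interval (CI x)) \<and>
       (\<forall>\<theta>. {x \<in> space M. \<theta> \<in> CI x} \<in> sets M) \<and>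
       (\<lambda>x. set_length (CI x)) \<in> borel_measurable M)"

lemma sets_two_groups [simp, measurable_cong]: "sets (two_groups \<theta> \<sigma> \<epsilon> Q) = sets borel"
  unfolding two_groups_def by (subst sets_measure_of) (auto simp: sets.sigma_sets_eq[of borel, simplified])

lemma space_two_groups [simp]: "space (two_groups \<theta> \<sigma> \<epsilon> Q) = UNIV"
  unfolding two_groups_def by (subst space_measure_of) auto

lemma emeasure_two_groups:
  assumes "A \<in> sets borel"
  shows "emeasure (two_groups \<theta> \<sigma> \<epsilon> Q) A =
           ennreal (1 - \<epsilon>) * emeasure (normal_measure \<theta> \<sigma>) A
         + ennreal \<epsilon> * emeasure (Q \<star> normal_measure 0 \<sigma>) A"
proof (rule emeasure_measure_of[OF two_groups_def])
  let ?\<mu> = "\<lambda>A. ennreal (1 - \<epsilon>) * emeasure (normal_measure \<theta> \<sigma>) A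
                + ennreal \<epsilon> * emeasure (Q \<star> normal_measure 0 \<sigma>) A"
  show "countably_additive (sets (two_groups \<theta> \<sigma> \<epsilon> Q)) ?\<mu>"
  proof (rule countably_additiveI)
    fix F :: "nat \<Rightarrow> real set"
    assume F: "range F \<subseteq> sets (two_groups \<theta> \<sigma> \<epsilon> Q)" "disjoint_family F"
    have 1: "(\<Sum>i. emeasure (normal_measure \<theta> \<sigma>) (F i)) = emeasure (normal_measure \<theta> \<sigma>) (\<Union>i. F i)"
      using F by (intro suminf_emeasure) auto
    have 2: "(\<Sum>i. emeasure (Q \<star> normal_measure 0 \<sigma>) (F i)) = emeasure (Q \<star> normal_measure 0 \<sigma>) (\<Union>i. F i)"
      using F by (intro suminf_emeasure) auto
    show "(\<Sum>i. ?\<mu> (F i)) = ?\<mu> (\<Union>i. F i)"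
      by (simp add: suminf_add[symmetric] 1 2)
  qed
qed (use assms in \<open>auto simp: positive_def\<close>)

lemma prob_space_two_groups:
  assumes "\<sigma> > 0" "0 \<le> \<epsilon>" "\<epsilon> \<le> 1" "Q \<in> space (prob_algebra borel)"
  shows "prob_space (two_groups \<theta> \<sigma> \<epsilon> Q)"
proof
  have Q: "prob_space Q" "sets Q = sets borel"
    using assms(4) by (auto simp: space_prob_algebra)
  have N: "prob_space (normal_measure \<mu> \<sigma>)" for \<mu>
    using prob_space_normal_density[OF assms(1)] .
  interpret pair_prob_space Q "normal_measure 0 \<sigma>"
    using Q N by (simp add: pair_prob_space_def pair_sigma_finite_def prob_space_imp_sigma_finite)
  have "prob_space (Q \<star> normal_measure 0 \<sigma>)"
    unfolding convolution_def
    by (rule prob_space_distr) (use Q(2) in measurable)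
  then have C: "emeasure (Q \<star> normal_measure 0 \<sigma>) UNIV = 1"
    using prob_space.emeasure_space_1 by fastforce
  have "emeasure (normal_measure \<theta> \<sigma>) UNIV = 1"
    using prob_space.emeasure_space_1[OF N] by simp
  with C show "emeasure (two_groups \<theta> \<sigma> \<epsilon> Q) (space (two_groups \<theta> \<sigma> \<epsilon> Q)) = 1"
    using assms(2,3) by (simp add: emeasure_two_groups flip: ennreal_plus)
qed

end

theory Submission
  imports Defs
begin

text \<open>
  An interval that covers without knowledge of \<open>\<epsilon>\<close> must also cover the null mean when the
  contamination level is \<open>\<epsilon>max\<close>. Suppose that a sample with null mean \<open>0\<close> and contamination
  level \<open>\<epsilon>\<close> cannot be distinguished from a sample with null mean \<open>\<theta>\<close> and contamination level
  \<open>\<epsilon>max\<close>. Then already under the first law the interval contains both \<open>0\<close> and \<open>\<theta>\<close> with positive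
  probability while being of length at most \<open>r n \<sigma> \<epsilon>\<close>, so \<open>r n \<sigma> \<epsilon> \<ge> \<bar>\<theta>\<bar>\<close> (\<open>two_point_bound\<close>).
  It remains to make \<open>\<theta>\<close> large.

  Both laws are taken to be finite Gaussian mixtures. If \<open>d\<close> denotes the difference of their
  weights at the locations \<open>\<sigma> x\<close>, then the chi-square divergence is at most twice the quadratic
  form \<open>\<Sum>\<^sub>i\<^sub>j d\<^sub>i d\<^sub>j exp (x\<^sub>i x\<^sub>j) = \<Sum>\<^sub>k (\<Sum>\<^sub>i d\<^sub>i x\<^sub>i\<^sup>k)\<^sup>2 / k!\<close>, and the laws of \<open>n\<close>
  observations are close as soon as this form is a small multiple of \<open>1 / n\<close>
  (\<open>iid_mixtures_close\<close>, \<open>exponential_form_le\<close>). So the mixing laws should have many moments in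
  common.

  The mixing law at level \<open>\<epsilon>max\<close> needs an atom of weight \<open>1 - \<epsilon>max\<close> at \<open>\<theta>\<close>; a second atom of
  constant weight at a multiple of \<open>- \<theta>\<close> balances it. Matching the mass and the mean with an
  atom at \<open>0\<close> leaves a form of order \<open>(\<theta> / \<sigma>)\<^sup>4\<close>, which allows \<open>\<theta> / \<sigma>\<close> of order \<open>n\<^sup>-\<^sup>1\<^sup>/\<^sup>4\<close>. If
  a share \<open>\<epsilon>\<close> of the mass may be moved freely in both laws, more moments can be matched:
  interpolating the two atoms at \<open>2 N + 1\<close> equidistant nodes of spacing \<open>h\<close> around \<open>0\<close> matches
  all moments of order up to \<open>2 N\<close>, and the interpolation weights away from \<open>0\<close> have total mass
  of order \<open>(\<theta> / (\<sigma> h))\<^sup>2\<close>, uniformly in \<open>N\<close> (\<open>interpolation_weights\<close>). This uniformity is the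
  heart of the argument. It rests on choosing the weight of the second atom so that the slowly
  decaying parts of the interpolation weights cancel. The budget \<open>\<epsilon>\<close> then permits \<open>\<theta> / \<sigma>\<close> of
  order \<open>h \<surd>\<epsilon>\<close>. With \<open>N\<close> of order \<open>ln (e n \<epsilon>\<^sup>2)\<close> and \<open>h\<close> of order \<open>1 / \<surd>N\<close>, the remaining
  moments contribute at most a constant times \<open>\<epsilon>\<^sup>2 exp (- 2 N) \<le> 1 / n\<close>, which gives the second
  term of the bound (\<open>adaptive_length_bound\<close>).
\<close>

section \<open>Likelihood ratios of product measures\<close>

lemma PiM_density:
  fixes f :: "'a \<Rightarrow> ennreal"
  assumes I: "finite I" and M: "prob_space M" and f [measurable]: "f \<in> borel_measurable M"
    and D: "prob_space (density M f)"
  shows "(\<Pi>\<^sub>M i\<in>I. density M f) = density (\<Pi>\<^sub>M i\<in>I. M) (\<lambda>x. \<Prod>i\<in>I. f (x i))"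
proof (rule sym, rule product_sigma_finite.PiM_eqI)
  interpret M: product_sigma_finite "\<lambda>i::'b. M"
    using M by (simp add: product_sigma_finite_def prob_space_imp_sigma_finite)
  show "product_sigma_finite (\<lambda>i::'b. density M f)"
    using D by (simp add: product_sigma_finite_def prob_space_imp_sigma_finite)
  show "sets (density (\<Pi>\<^sub>M i\<in>I. M) (\<lambda>x. \<Prod>i\<in>I. f (x i))) = sets (\<Pi>\<^sub>M i\<in>I. density M f)"
    by (simp cong: sets_PiM_cong)
  fix A assume A: "\<And>i. i \<in> I \<Longrightarrow> A i \<in> sets (density M f)"
  then have A' [measurable]: "\<And>i. i \<in> I \<Longrightarrow> A i \<in> sets M" by simp
  have "emeasure (density (\<Pi>\<^sub>M i\<in>I. M) (\<lambda>x. \<Prod>i\<in>I. f (x i))) (Pi\<^sub>E I A)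
      = (\<integral>\<^sup>+x. (\<Prod>i\<in>I. f (x i)) * indicator (Pi\<^sub>E I A) x \<partial>(\<Pi>\<^sub>M i\<in>I. M))"
    using I A' by (subst emeasure_density) (auto intro!: sets_PiM_I_finite)
  also have "\<dots> = (\<integral>\<^sup>+x. (\<Prod>i\<in>I. f (x i) * indicator (A i) (x i)) \<partial>(\<Pi>\<^sub>M i\<in>I. M))"
  proof (rule nn_integral_cong)
    fix x assume "x \<in> space (\<Pi>\<^sub>M i\<in>I. M)"
    then have "x \<in> extensional I" by (auto simp: space_PiM PiE_def)
    then have "indicator (Pi\<^sub>E I A) x = (\<Prod>i\<in>I. indicator (A i) (x i) :: ennreal)"
      using I by (auto simp: indicator_def PiE_def Pi_def split: if_splits)
    then show "(\<Prod>i\<in>I. f (x i)) * indicator (Pi\<^sub>E I A) x = (\<Prod>i\<in>I. f (x i) * indicator (A i) (x i))"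
      by (simp add: prod.distrib)
  qed
  also have "\<dots> = (\<Prod>i\<in>I. \<integral>\<^sup>+x. f x * indicator (A i) x \<partial>M)"
    using I A' by (intro M.product_nn_integral_prod) auto
  also have "\<dots> = (\<Prod>i\<in>I. emeasure (density M f) (A i))"
    using A' by (intro prod.cong refl) (simp add: emeasure_density)
  finally show "emeasure (density (\<Pi>\<^sub>M i\<in>I. M) (\<lambda>x. \<Prod>i\<in>I. f (x i))) (Pi\<^sub>E I A)
      = (\<Prod>i\<in>I. emeasure (density M f) (A i))" .
qed (fact I)

text \<open>
  For the likelihood ratio \<open>Z\<close> of the product measures, \<open>Z\<^sup>2\<close> has expectation \<open>(\<integral>L\<^sup>2)\<^sup>n\<close> with \<open>n = card I\<close>, so the
  hypothesis says that the chi-square divergence of the \<open>n\<close>-fold products is at most \<open>\<eta>\<^sup>2\<close>. The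
  chi-square divergence, unlike the total variation distance, is computed exactly for products.
\<close>

lemma product_measure_le_add:
  fixes L :: "'a \<Rightarrow> real"
  assumes M: "prob_space M" and D: "prob_space (density M L)"
    and L [measurable]: "L \<in> borel_measurable M" and L0: "\<And>x. 0 \<le> L x"
    and L2: "integrable M (\<lambda>x. (L x)\<^sup>2)" and "0 < \<eta>"
    and chi: "(\<integral>x. (L x)\<^sup>2 \<partial>M) ^ card I \<le> 1 + \<eta>\<^sup>2"
    and I: "finite I" and B: "B \<in> sets (\<Pi>\<^sub>M i\<in>I. M)"
  shows "measure (\<Pi>\<^sub>M i\<in>I. density M L) B \<le> measure (\<Pi>\<^sub>M i\<in>I. M) B + \<eta>"
proof -
  interpret M: prob_space M by fact
  interpret S: product_sigma_finite "\<lambda>i::'b. M"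
    using M by (simp add: product_sigma_finite_def prob_space_imp_sigma_finite)
  interpret P: product_prob_space "\<lambda>i::'b. M" I
    using M by (simp add: product_prob_space_def product_prob_space_axioms_def product_sigma_finite_def
        prob_space_imp_sigma_finite)
  let ?P = "\<Pi>\<^sub>M i\<in>I. M"
  define Z where "Z x = (\<Prod>i\<in>I. L (x i))" for x
  have Zm [measurable]: "Z \<in> borel_measurable ?P" unfolding Z_def by measurable
  have Z0: "0 \<le> Z x" for x unfolding Z_def by (intro prod_nonneg) (simp add: L0)
  have iL: "integrable M L"
    by (rule integrableI_nn_integral_finite[where x=1])
       (use L0 prob_space.emeasure_space_1[OF D] in \<open>auto simp: emeasure_density\<close>)
  have "(\<integral>x. L x \<partial>M) = 1"
    using prob_space.emeasure_space_1[OF D] L0 iL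
    by (simp add: emeasure_density nn_integral_eq_integral)
  then have EZ: "integrable ?P Z" "(\<integral>x. Z x \<partial>?P) = 1"
    using S.product_integrable_prod[of I "\<lambda>_. L"] S.product_integral_prod[of I "\<lambda>_. L"] I iL
    by (auto simp: Z_def[abs_def])
  have Z2: "integrable ?P (\<lambda>x. (Z x)\<^sup>2)" "(\<integral>x. (Z x)\<^sup>2 \<partial>?P) = (\<integral>x. (L x)\<^sup>2 \<partial>M) ^ card I"
    using S.product_integrable_prod[of I "\<lambda>_ x. (L x)\<^sup>2"] S.product_integral_prod[of I "\<lambda>_ x. (L x)\<^sup>2"] I L2
    by (auto simp: Z_def[abs_def] prod_power_distrib)
  have dens: "(\<Pi>\<^sub>M i\<in>I. density M L) = density ?P Z"
    using PiM_density[OF I M, of L] D by (simp add: Z_def prod_ennreal L0)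
  have iB: "integrable ?P (\<lambda>x. Z x * indicator B x)"
    by (rule integrable_real_mult_indicator[OF B EZ(1)])
  have "emeasure (density ?P Z) B = (\<integral>\<^sup>+x. ennreal (Z x * indicator B x) \<partial>?P)"
    using B by (simp add: emeasure_density ennreal_mult' ennreal_indicator Z0)
  also have "\<dots> = ennreal (\<integral>x. Z x * indicator B x \<partial>?P)"
    using iB Z0 by (intro nn_integral_eq_integral) auto
  finally have m: "measure (density ?P Z) B = (\<integral>x. Z x * indicator B x \<partial>?P)"
    using Z0 by (simp add: measure_def integral_nonneg_AE)
  \<comment> \<open>The square of \<open>Z - 1 - \<eta>\<close> is nonnegative; this replaces the Cauchy-Schwarz inequality.\<close>
  have pw: "Z x * indicator B x \<le> indicator B x + (((Z x)\<^sup>2 - 2 * Z x + 1) / (2 * \<eta>) + \<eta> / 2)" for x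
  proof -
    have "0 \<le> (Z x - 1 - \<eta>)\<^sup>2 / (2 * \<eta>)" using \<open>0 < \<eta>\<close> by simp
    also have "\<dots> = (Z x - 1)\<^sup>2 / (2 * \<eta>) + \<eta> / 2 - (Z x - 1)"
      using \<open>0 < \<eta>\<close> by (simp add: field_simps power2_eq_square)
    finally have 1: "Z x - 1 \<le> (Z x - 1)\<^sup>2 / (2 * \<eta>) + \<eta> / 2" by simp
    have 2: "0 \<le> (Z x - 1)\<^sup>2 / (2 * \<eta>) + \<eta> / 2" using \<open>0 < \<eta>\<close> by simp
    have 3: "(Z x - 1)\<^sup>2 = (Z x)\<^sup>2 - 2 * Z x + 1" by (simp add: power2_eq_square algebra_simps)
    show ?thesis using 1 2 unfolding 3 by (auto simp: indicator_def)
  qed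
  have i1: "integrable ?P (indicator B :: _ \<Rightarrow> real)" using B by (simp add: P.P.emeasure_eq_measure)
  have "(\<integral>x. Z x * indicator B x \<partial>?P)
      \<le> (\<integral>x. indicator B x + (((Z x)\<^sup>2 - 2 * Z x + 1) / (2 * \<eta>) + \<eta> / 2) \<partial>?P)"
    using iB i1 EZ Z2 by (intro integral_mono pw Bochner_Integration.integrable_add
        Bochner_Integration.integrable_diff Bochner_Integration.integrable_divide) auto
  also have "\<dots> = measure ?P B + (((\<integral>x. (L x)\<^sup>2 \<partial>M) ^ card I - 2 + 1) / (2 * \<eta>) + \<eta> / 2)"
    using i1 EZ Z2 B P.P.prob_space by simp
  also have "\<dots> \<le> measure ?P B + (\<eta>\<^sup>2 / (2 * \<eta>) + \<eta> / 2)"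
    using chi \<open>0 < \<eta>\<close> by (intro add_mono divide_right_mono) auto
  also have "\<dots> = measure ?P B + \<eta>" using \<open>0 < \<eta>\<close> by (simp add: power2_eq_square)
  finally show ?thesis by (simp add: dens m)
qed

section \<open>Finite Gaussian mixtures in the two-groups model\<close>

text \<open>
  Locations are measured in units of \<open>\<sigma>\<close>, which makes the chi-square divergence between two
  mixtures independent of \<open>\<sigma>\<close>.
\<close>

definition gaussian_mixture :: "'i set \<Rightarrow> ('i \<Rightarrow> real) \<Rightarrow> ('i \<Rightarrow> real) \<Rightarrow> real \<Rightarrow> real \<Rightarrow> real" where
  "gaussian_mixture I x g \<sigma> y = (\<Sum>i\<in>I. g i * normal_density (\<sigma> * x i) \<sigma> y)"

lemma borel_measurable_gaussian_mixture [measurable]: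
  "gaussian_mixture I x g \<sigma> \<in> borel_measurable borel"
  unfolding gaussian_mixture_def by measurable

lemma integrable_gaussian_mixture: "\<sigma> > 0 \<Longrightarrow> integrable lborel (gaussian_mixture I x g \<sigma>)"
  unfolding gaussian_mixture_def by (intro Bochner_Integration.integrable_sum) auto

lemma integral_gaussian_mixture:
  "\<sigma> > 0 \<Longrightarrow> (\<integral>y. gaussian_mixture I x g \<sigma> y \<partial>lborel) = sum g I"
  unfolding gaussian_mixture_def by (subst Bochner_Integration.integral_sum) auto

lemma emeasure_normal_translate:
  assumes "\<sigma> > 0" "A \<in> sets borel"
  shows "emeasure (normal_measure 0 \<sigma>) {a. a + t \<in> A} = emeasure (normal_measure t \<sigma>) A"
proof -
  note [measurable] = assms(2)
  have S: "{a. a + t \<in> A} \<in> sets borel" by measurable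
  have "emeasure (normal_measure t \<sigma>) A = (\<integral>\<^sup>+x. ennreal (normal_density t \<sigma> x) * indicator A x \<partial>lborel)"
    by (simp add: emeasure_density)
  also have "\<dots> = (\<integral>\<^sup>+x. ennreal (normal_density t \<sigma> (t + 1 * x)) * indicator A (t + 1 * x) \<partial>lborel)"
    by (subst nn_integral_real_affine[where c=1 and t=t]) auto
  also have "\<dots> = (\<integral>\<^sup>+x. ennreal (normal_density 0 \<sigma> x) * indicator {a. a + t \<in> A} x \<partial>lborel)"
    by (intro nn_integral_cong) (auto simp: normal_density_def indicator_def add.commute)
  also have "\<dots> = emeasure (normal_measure 0 \<sigma>) {a. a + t \<in> A}"
    using S by (simp add: emeasure_density)
  finally show ?thesis by simp
qed

lemma emeasure_density_mixture:
  assumes "finite I" "\<And>i. i \<in> I \<Longrightarrow> 0 \<le> g i" "A \<in> sets borel"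
  shows "emeasure (density lborel (gaussian_mixture I x g \<sigma>)) A
    = (\<Sum>i\<in>I. ennreal (g i) * emeasure (normal_measure (\<sigma> * x i) \<sigma>) A)"
proof -
  note [measurable] = assms(3)
  have "emeasure (density lborel (gaussian_mixture I x g \<sigma>)) A
      = (\<integral>\<^sup>+y. ennreal (gaussian_mixture I x g \<sigma> y) * indicator A y \<partial>lborel)"
    by (simp add: emeasure_density)
  also have "\<dots> = (\<integral>\<^sup>+y. (\<Sum>i\<in>I. ennreal (g i) * (ennreal (normal_density (\<sigma> * x i) \<sigma> y) * indicator A y)) \<partial>lborel)"
    using assms(2) unfolding gaussian_mixture_def
    by (intro nn_integral_cong)
       (simp add: sum_ennreal[symmetric] ennreal_mult sum_distrib_right mult.assoc)
  also have "\<dots> = (\<Sum>i\<in>I. ennreal (g i) * (\<integral>\<^sup>+y. ennreal (normal_density (\<sigma> * x i) \<sigma> y) * indicator A y \<partial>lborel))"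
    by (subst nn_integral_sum) (auto simp: nn_integral_cmult)
  finally show ?thesis by (simp add: emeasure_density)
qed

text \<open>
  A finite mixture with an atom of weight at least \<open>1 - \<epsilon>\<close> at \<open>x k\<close> belongs to the two-groups
  model with null mean \<open>\<sigma> x k\<close>: the remaining weights, divided by \<open>\<epsilon>\<close>, form the law \<open>Q\<close>. Thus
  the choice of a pair of contamination laws reduces to the choice of two weight vectors.
\<close>

lemma two_groups_eq_mixture:
  fixes x g :: "'i \<Rightarrow> real"
  assumes I: "finite I" "k \<in> I" and g0: "\<And>i. i \<in> I \<Longrightarrow> 0 \<le> g i" and g1: "sum g I = 1"
    and gk: "1 - \<epsilon> \<le> g k" and "\<sigma> > 0" "0 \<le> \<epsilon>" "\<epsilon> \<le> 1"
  shows "\<exists>Q\<in>space (prob_algebra borel).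
    two_groups (\<sigma> * x k) \<sigma> \<epsilon> Q = density lborel (gaussian_mixture I x g \<sigma>)"
proof -
  have Qs: "\<exists>Q\<in>space (prob_algebra borel). \<forall>A\<in>sets borel.
     emeasure (Q \<star> normal_measure 0 \<sigma>) A = (\<Sum>i\<in>I. ennreal (w i) * emeasure (normal_measure (\<sigma> * x i) \<sigma>) A)"
    if w: "\<And>i. i \<in> I \<Longrightarrow> 0 \<le> w i" "sum w I = 1" for w :: "'i \<Rightarrow> real"
  proof -
    define Q where "Q = distr (point_measure I (\<lambda>i. ennreal (w i))) borel (\<lambda>i. \<sigma> * x i)"
    have "prob_space (point_measure I (\<lambda>i. ennreal (w i)))"
      using I w by (intro prob_spaceI) (simp add: emeasure_point_measure_finite2 space_point_measure sum_ennreal)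
    then have pQ: "prob_space Q" unfolding Q_def by (rule prob_space.prob_space_distr) simp
    have sQ: "sets Q = sets borel" by (simp add: Q_def)
    have pN: "prob_space (normal_measure 0 \<sigma>)" using prob_space_normal_density[OF \<open>\<sigma> > 0\<close>] .
    have "emeasure (Q \<star> normal_measure 0 \<sigma>) A = (\<Sum>i\<in>I. ennreal (w i) * emeasure (normal_measure (\<sigma> * x i) \<sigma>) A)"
      if A: "A \<in> sets borel" for A
    proof -
      note [measurable] = A
      have "emeasure (Q \<star> normal_measure 0 \<sigma>) A = (\<integral>\<^sup>+t. emeasure (normal_measure 0 \<sigma>) {a. a + t \<in> A} \<partial>Q)"
        using A pQ pN sQ sets_eq_imp_space_eq[OF sQ]
        by (intro convolution_emeasure) (auto simp: prob_space.finite_measure)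
      also have "\<dots> = (\<integral>\<^sup>+t. (\<integral>\<^sup>+y. ennreal (normal_density 0 \<sigma> y) * indicator A (y + t) \<partial>lborel) \<partial>Q)"
        by (intro nn_integral_cong) (subst emeasure_density, auto simp: indicator_def)
      also have "\<dots> = (\<integral>\<^sup>+i. (\<integral>\<^sup>+y. ennreal (normal_density 0 \<sigma> y) * indicator A (y + \<sigma> * x i) \<partial>lborel) \<partial>point_measure I (\<lambda>i. ennreal (w i)))"
        unfolding Q_def by (subst nn_integral_distr) auto
      also have "\<dots> = (\<Sum>i\<in>I. ennreal (w i) * (\<integral>\<^sup>+y. ennreal (normal_density 0 \<sigma> y) * indicator A (y + \<sigma> * x i) \<partial>lborel))"
        using I by (simp add: nn_integral_point_measure_finite mult.commute)
      also have "\<dots> = (\<Sum>i\<in>I. ennreal (w i) * emeasure (normal_measure 0 \<sigma>) {a. a + \<sigma> * x i \<in> A})"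
        by (intro sum.cong refl) (subst emeasure_density, auto simp: indicator_def)
      finally show ?thesis using A \<open>\<sigma> > 0\<close> by (simp add: emeasure_normal_translate)
    qed
    then show ?thesis using pQ sQ by (auto simp: space_prob_algebra intro!: bexI[of _ Q])
  qed
  \<comment> \<open>For \<open>\<epsilon> = 0\<close> all mass of \<open>g\<close> sits at \<open>k\<close>, and \<open>g\<close> itself is a valid probability vector.\<close>
  define w where "w i = (if \<epsilon> = 0 then g i else (g i - (if i = k then 1 - \<epsilon> else 0)) / \<epsilon>)" for i
  have w0: "0 \<le> w i" if "i \<in> I" for i
    using that g0 gk \<open>0 \<le> \<epsilon>\<close> by (auto simp: w_def)
  have ws: "sum w I = 1"
  proof (cases "\<epsilon> = 0")
    case False
    have "sum w I = (sum g I - (\<Sum>i\<in>I. if i = k then 1 - \<epsilon> else 0)) / \<epsilon>"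
      using False by (simp add: w_def sum_divide_distrib[symmetric] sum_subtractf)
    also have "\<dots> = 1" using I g1 False by simp
    finally show ?thesis .
  qed (simp add: w_def g1)
  have eq0: "g i = (if i = k then 1 else 0)" if "\<epsilon> = 0" "i \<in> I" for i
  proof -
    have "sum g (I - {k}) = 1 - g k" using I g1 by (simp add: sum_diff1)
    moreover have "sum g (I - {k}) \<ge> 0" using g0 by (intro sum_nonneg) auto
    ultimately have "sum g (I - {k}) = 0" "g k = 1" using gk that by auto
    then show ?thesis using that I g0 sum_nonneg_eq_0_iff[of "I - {k}" g] by auto
  qed
  have eq: "g i = (1 - \<epsilon>) * (if i = k then 1 else 0) + \<epsilon> * w i" if "i \<in> I" for i
    using eq0 that by (cases "\<epsilon> = 0") (auto simp: w_def)
  obtain Q where Q: "Q \<in> space (prob_algebra borel)"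
    "\<And>A. A \<in> sets borel \<Longrightarrow> emeasure (Q \<star> normal_measure 0 \<sigma>) A = (\<Sum>i\<in>I. ennreal (w i) * emeasure (normal_measure (\<sigma> * x i) \<sigma>) A)"
    using Qs[OF w0 ws] by auto
  have "two_groups (\<sigma> * x k) \<sigma> \<epsilon> Q = density lborel (gaussian_mixture I x g \<sigma>)"
  proof (rule measure_eqI)
    fix A assume "A \<in> sets (two_groups (\<sigma> * x k) \<sigma> \<epsilon> Q)"
    then have A: "A \<in> sets borel" by simp
    let ?N = "\<lambda>i. emeasure (normal_measure (\<sigma> * x i) \<sigma>) A"
    have "emeasure (density lborel (gaussian_mixture I x g \<sigma>)) A = (\<Sum>i\<in>I. ennreal (g i) * ?N i)"
      by (rule emeasure_density_mixture[OF I(1) g0 A])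
    also have "\<dots> = (\<Sum>i\<in>I. ennreal (1 - \<epsilon>) * ((if i = k then 1 else 0) * ?N i) + ennreal \<epsilon> * (ennreal (w i) * ?N i))"
    proof (rule sum.cong[OF refl])
      fix i assume i: "i \<in> I"
      have "ennreal (g i) = ennreal (1 - \<epsilon>) * (if i = k then 1 else 0) + ennreal \<epsilon> * ennreal (w i)"
        unfolding eq[OF i] using w0[OF i] \<open>0 \<le> \<epsilon>\<close> \<open>\<epsilon> \<le> 1\<close>
        by (auto simp: ennreal_plus ennreal_mult)
      then show "ennreal (g i) * ?N i = ennreal (1 - \<epsilon>) * ((if i = k then 1 else 0) * ?N i) + ennreal \<epsilon> * (ennreal (w i) * ?N i)"
        by (simp add: distrib_right mult.assoc)
    qed
    also have "\<dots> = ennreal (1 - \<epsilon>) * ?N k + ennreal \<epsilon> * (\<Sum>i\<in>I. ennreal (w i) * ?N i)"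
      using I by (simp add: sum.distrib sum_distrib_left[symmetric] if_distrib[of "\<lambda>t. t * _"] cong: if_cong)
    also have "\<dots> = emeasure (two_groups (\<sigma> * x k) \<sigma> \<epsilon> Q) A"
      using A Q by (simp add: emeasure_two_groups)
    finally show "emeasure (two_groups (\<sigma> * x k) \<sigma> \<epsilon> Q) A = emeasure (density lborel (gaussian_mixture I x g \<sigma>)) A" by simp
  qed simp
  then show ?thesis using Q by blast
qed

section \<open>Chi-square divergence of Gaussian mixtures\<close>

text \<open>
  Completing the square. The factor \<open>exp (a * b)\<close> is the source of the quadratic form that
  measures the distance of two mixtures.
\<close>

lemma normal_density_mult:
  assumes "\<sigma> > 0"
  shows "normal_density (\<sigma> * a) \<sigma> y * normal_density (\<sigma> * b) \<sigma> y
    = exp (a * b) * normal_density (\<sigma> * (a + b)) \<sigma> y * normal_density 0 \<sigma> y"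
proof -
  have *: "- (y - \<sigma> * a)\<^sup>2 / (2 * \<sigma>\<^sup>2) + - (y - \<sigma> * b)\<^sup>2 / (2 * \<sigma>\<^sup>2)
      = a * b + - (y - \<sigma> * (a + b))\<^sup>2 / (2 * \<sigma>\<^sup>2) + - (y - 0)\<^sup>2 / (2 * \<sigma>\<^sup>2)"
    using assms by (simp add: field_simps power2_eq_square)
  have "exp (- (y - \<sigma> * a)\<^sup>2 / (2 * \<sigma>\<^sup>2)) * exp (- (y - \<sigma> * b)\<^sup>2 / (2 * \<sigma>\<^sup>2))
      = exp (a * b) * exp (- (y - \<sigma> * (a + b))\<^sup>2 / (2 * \<sigma>\<^sup>2)) * exp (- (y - 0)\<^sup>2 / (2 * \<sigma>\<^sup>2))"
    by (simp only: exp_add[symmetric] *)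
  then show ?thesis unfolding normal_density_def by simp
qed

text \<open>
  An atom of weight at least \<open>1 / 2\<close> at the origin gives \<open>f0 \<ge> \<phi> / 2\<close> for the centred normal
  density \<open>\<phi>\<close>. In the chi-square divergence \<open>\<integral>(f1 - f0)\<^sup>2 / f0\<close> the denominator may therefore be
  replaced by \<open>\<phi> / 2\<close>, after which the integrand is a linear combination of normal densities.
\<close>

lemma mixture_chi_square:
  fixes x g0 g1 :: "'i \<Rightarrow> real"
  assumes I: "finite I" "k \<in> I" "x k = 0" and "\<sigma> > 0"
    and g0: "\<And>i. i \<in> I \<Longrightarrow> 0 \<le> g0 i" "sum g0 I = 1" "1 / 2 \<le> g0 k"
    and g1: "\<And>i. i \<in> I \<Longrightarrow> 0 \<le> g1 i" "sum g1 I = 1"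
  defines "f0 \<equiv> gaussian_mixture I x g0 \<sigma>" and "f1 \<equiv> gaussian_mixture I x g1 \<sigma>"
  shows "integrable (density lborel f0) (\<lambda>y. (f1 y / f0 y)\<^sup>2)" (is ?A)
    and "(\<integral>y. (f1 y / f0 y)\<^sup>2 \<partial>density lborel f0)
      \<le> 1 + 2 * (\<Sum>i\<in>I. \<Sum>j\<in>I. (g1 i - g0 i) * (g1 j - g0 j) * exp (x i * x j))" (is ?B)
    and "density lborel f1 = density (density lborel f0) (\<lambda>y. f1 y / f0 y)" (is ?C)
    and "\<And>y. 0 < f0 y" and "\<And>y. 0 \<le> f1 y"
proof -
  have [measurable]: "f0 \<in> borel_measurable borel" "f1 \<in> borel_measurable borel"
    unfolding f0_def f1_def by auto
  let ?\<phi> = "normal_density 0 \<sigma>"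
  have \<phi>: "0 < ?\<phi> y" for y using normal_density_pos[OF \<open>\<sigma> > 0\<close>] .
  have half: "?\<phi> y / 2 \<le> f0 y" for y
  proof -
    have "?\<phi> y / 2 \<le> g0 k * normal_density (\<sigma> * x k) \<sigma> y"
      using g0(3) I(3) \<phi>[of y] by simp
    also have "\<dots> \<le> f0 y" unfolding f0_def gaussian_mixture_def
      using I g0 by (intro member_le_sum) auto
    finally show ?thesis .
  qed
  show f0: "0 < f0 y" for y using half[of y] \<phi>[of y] by linarith
  show f1: "0 \<le> f1 y" for y unfolding f1_def gaussian_mixture_def using g1 by (intro sum_nonneg) auto
  define d where "d i = g1 i - g0 i" for i
  define R where "R y = 2 * f1 y - f0 y
    + 2 * (\<Sum>i\<in>I. \<Sum>j\<in>I. d i * d j * exp (x i * x j) * normal_density (\<sigma> * (x i + x j)) \<sigma> y)" for y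
  have diff: "f1 y - f0 y = (\<Sum>i\<in>I. d i * normal_density (\<sigma> * x i) \<sigma> y)" for y
    unfolding f0_def f1_def gaussian_mixture_def d_def by (simp add: sum_subtractf algebra_simps)
  have sq: "(f1 y - f0 y)\<^sup>2
      = (\<Sum>i\<in>I. \<Sum>j\<in>I. d i * d j * exp (x i * x j) * normal_density (\<sigma> * (x i + x j)) \<sigma> y) * ?\<phi> y" for y
  proof -
    have "(f1 y - f0 y)\<^sup>2 = (\<Sum>i\<in>I. \<Sum>j\<in>I. (d i * d j)
        * (normal_density (\<sigma> * x i) \<sigma> y * normal_density (\<sigma> * x j) \<sigma> y))"
      unfolding diff power2_eq_square sum_product by (intro sum.cong refl) (simp add: mult_ac)
    then show ?thesis
      unfolding normal_density_mult[OF \<open>\<sigma> > 0\<close>] sum_distrib_right by (simp add: mult.assoc)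
  qed
  \<comment> \<open>With \<open>f1\<^sup>2 / f0 = 2 f1 - f0 + (f1 - f0)\<^sup>2 / f0\<close>, the integral of \<open>R\<close> is one plus twice the quadratic form.\<close>
  have R: "f0 y * (f1 y / f0 y)\<^sup>2 \<le> R y" for y
  proof -
    define S where "S = (\<Sum>i\<in>I. \<Sum>j\<in>I. d i * d j * exp (x i * x j) * normal_density (\<sigma> * (x i + x j)) \<sigma> y)"
    have S: "(f1 y - f0 y)\<^sup>2 = S * ?\<phi> y" unfolding S_def by (rule sq)
    have "0 \<le> S * ?\<phi> y" unfolding S[symmetric] by simp
    then have "0 \<le> S" using \<phi>[of y] by (simp add: zero_le_mult_iff)
    have "f0 y * (f1 y / f0 y)\<^sup>2 = 2 * f1 y - f0 y + (f1 y - f0 y)\<^sup>2 / f0 y"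
      using f0[of y] by (simp add: field_simps power2_eq_square)
    also have "(f1 y - f0 y)\<^sup>2 / f0 y \<le> (S * ?\<phi> y) / (?\<phi> y / 2)"
      unfolding S using half[of y] \<phi>[of y] f0[of y] \<open>0 \<le> S\<close> by (intro divide_left_mono) auto
    also have "\<dots> = 2 * S" using \<phi>[of y] by simp
    finally show ?thesis by (simp add: R_def S_def)
  qed
  have iR: "integrable lborel R" unfolding R_def
    using \<open>\<sigma> > 0\<close> by (intro Bochner_Integration.integrable_add Bochner_Integration.integrable_diff
      Bochner_Integration.integrable_sum integrable_mult_right)
      (auto simp: f0_def f1_def integrable_gaussian_mixture)
  have IR: "(\<integral>y. R y \<partial>lborel) = 1 + 2 * (\<Sum>i\<in>I. \<Sum>j\<in>I. d i * d j * exp (x i * x j))"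
    unfolding R_def using \<open>\<sigma> > 0\<close> g0 g1
    by (simp add: f0_def f1_def integrable_gaussian_mixture integral_gaussian_mixture)
  have i: "integrable lborel (\<lambda>y. f0 y * (f1 y / f0 y)\<^sup>2)"
    by (rule Bochner_Integration.integrable_bound[OF iR])
       (use R f0 in \<open>auto intro!: AE_I2 simp: abs_mult less_imp_le intro: order_trans[OF _ abs_ge_self]\<close>)
  show ?A using i f0 by (subst integrable_density) (auto simp: less_imp_le)
  have "(\<integral>y. (f1 y / f0 y)\<^sup>2 \<partial>density lborel f0) = (\<integral>y. f0 y * (f1 y / f0 y)\<^sup>2 \<partial>lborel)"
    using f0 by (subst integral_density) (auto simp: less_imp_le)
  also have "\<dots> \<le> (\<integral>y. R y \<partial>lborel)" by (intro integral_mono i iR R)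
  finally show ?B unfolding IR d_def .
  show ?C
    using f0 f1 by (subst density_density_eq)
      (auto simp: ennreal_mult[symmetric] less_imp_le intro!: density_cong AE_I2 arg_cong[where f=ennreal],
       metis less_irrefl nonzero_mult_div_cancel_left times_divide_eq_right)
qed

text \<open>
  The bound \<open>1 / 40\<close> makes the chi-square divergence of the products at most \<open>exp (1 / 20) - 1 \<le>
  (1 / 4)\<^sup>2\<close>.
\<close>

lemma iid_mixtures_close:
  fixes x g0 g1 :: "'i \<Rightarrow> real"
  assumes I: "finite I" "k \<in> I" "x k = 0" and "\<sigma> > 0"
    and g0: "\<And>i. i \<in> I \<Longrightarrow> 0 \<le> g0 i" "sum g0 I = 1" "1 / 2 \<le> g0 k"
    and g1: "\<And>i. i \<in> I \<Longrightarrow> 0 \<le> g1 i" "sum g1 I = 1"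
    and chi: "real n * (\<Sum>i\<in>I. \<Sum>j\<in>I. (g1 i - g0 i) * (g1 j - g0 j) * exp (x i * x j)) \<le> 1 / 40"
    and B: "B \<in> sets (\<Pi>\<^sub>M i\<in>{..<n}. borel)"
  shows "measure (\<Pi>\<^sub>M i\<in>{..<n}. density lborel (gaussian_mixture I x g1 \<sigma>)) B
    \<le> measure (\<Pi>\<^sub>M i\<in>{..<n}. density lborel (gaussian_mixture I x g0 \<sigma>)) B + 1 / 4"
proof -
  define f0 where "f0 = gaussian_mixture I x g0 \<sigma>"
  define f1 where "f1 = gaussian_mixture I x g1 \<sigma>"
  define \<kappa> where "\<kappa> = (\<Sum>i\<in>I. \<Sum>j\<in>I. (g1 i - g0 i) * (g1 j - g0 j) * exp (x i * x j))"
  note c = mixture_chi_square[where I=I and k=k and x=x and \<sigma>=\<sigma> and ?g0.0=g0 and ?g1.0=g1, OF I \<open>\<sigma> > 0\<close> g0 g1, folded f0_def f1_def \<kappa>_def]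
  have p: "prob_space (density lborel (gaussian_mixture I x g \<sigma>))"
    if "\<And>i. i \<in> I \<Longrightarrow> 0 \<le> g i" "sum g I = 1" for g
  proof
    have "(\<integral>\<^sup>+y. ennreal (gaussian_mixture I x g \<sigma> y) \<partial>lborel) = ennreal (\<integral>y. gaussian_mixture I x g \<sigma> y \<partial>lborel)"
      using that \<open>\<sigma> > 0\<close> by (intro nn_integral_eq_integral integrable_gaussian_mixture)
        (auto simp: gaussian_mixture_def intro!: AE_I2 sum_nonneg)
    then show "emeasure (density lborel (gaussian_mixture I x g \<sigma>)) (space (density lborel (gaussian_mixture I x g \<sigma>))) = 1"
      using that \<open>\<sigma> > 0\<close> by (simp add: emeasure_density integral_gaussian_mixture)
  qed
  have [measurable]: "f0 \<in> borel_measurable borel" "f1 \<in> borel_measurable borel"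
    unfolding f0_def f1_def by auto
  have "(\<integral>y. (f1 y / f0 y)\<^sup>2 \<partial>density lborel f0) ^ card {..<n} \<le> (1 + 2 * \<kappa>) ^ n"
    using c(2) by (simp add: power_mono integral_nonneg_AE)
  also have "\<dots> \<le> exp (2 * \<kappa>) ^ n"
  proof (rule power_mono)
    have "0 \<le> (\<integral>y. (f1 y / f0 y)\<^sup>2 \<partial>density lborel f0)" by simp
    then show "0 \<le> 1 + 2 * \<kappa>" using c(2) by linarith
  qed (rule exp_ge_add_one_self)
  also have "\<dots> = exp (2 * (real n * \<kappa>))" by (simp add: exp_of_nat_mult[symmetric] mult_ac)
  also have "\<dots> \<le> exp (1 / 20)" using chi by (simp add: \<kappa>_def)
  also have "\<dots> \<le> 1 + (1 / 4)\<^sup>2" using exp_bound[of "1/20"] by (simp add: power2_eq_square)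
  finally have chi': "(\<integral>y. (f1 y / f0 y)\<^sup>2 \<partial>density lborel f0) ^ card {..<n} \<le> 1 + (1 / 4)\<^sup>2" .
  have B': "B \<in> sets (\<Pi>\<^sub>M i\<in>{..<n}. density lborel f0)"
    using B by (simp cong: sets_PiM_cong)
  have "measure (\<Pi>\<^sub>M i\<in>{..<n}. density (density lborel f0) (\<lambda>y. f1 y / f0 y)) B
    \<le> measure (\<Pi>\<^sub>M i\<in>{..<n}. density lborel f0) B + 1 / 4"
    by (rule product_measure_le_add[where L="\<lambda>y. f1 y / f0 y"])
       (use p[OF g0(1,2)] p[OF g1] c chi' B' in \<open>auto simp: f0_def[symmetric] f1_def[symmetric] less_imp_le\<close>)
  then show ?thesis using c(3)[symmetric] by (simp only: f0_def f1_def)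
qed

section \<open>Confidence intervals and two indistinguishable laws\<close>

lemma le_set_length: "a \<in> S \<Longrightarrow> b \<in> S \<Longrightarrow> ereal \<bar>a - b\<bar> \<le> set_length S"
proof (induction a b rule: linorder_wlog)
  case (le a b)
  have "ereal (b - a) \<le> (SUP x\<in>S. ereal x) - (INF x\<in>S. ereal x)"
    unfolding ereal_minus(1)[symmetric]
    using le by (intro ereal_minus_mono SUP_upper INF_lower)
  then show ?case using le by (simp add: set_length_def)
next
  case (sym a b) then show ?case by (simp add: abs_minus_commute)
qed

text \<open>
  Under \<open>P0\<close> the set contains \<open>\<theta>0\<close>, contains \<open>\<theta>1\<close>, and is short, with probabilities whose
  complements add up to at most \<open>3 \<delta> + 1 / 4 < 1\<close>. So on some sample all three hold, and a set
  containing both points is at least as long as their distance.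
\<close>

lemma two_point_bound:
  assumes CI: "confidence_interval n CI" and "\<delta> < 1 / 4"
    and P0: "prob_space P0" "sets P0 = sets (\<Pi>\<^sub>M i\<in>{..<n}. borel)"
    and P1: "sets P1 = sets (\<Pi>\<^sub>M i\<in>{..<n}. borel)"
    and close: "\<And>B. B \<in> sets (\<Pi>\<^sub>M i\<in>{..<n}. borel) \<Longrightarrow> measure P1 B \<le> measure P0 B + 1 / 4"
    and cov0: "1 - \<delta> \<le> \<P>(x in P0. \<theta>0 \<in> CI x)" and cov1: "1 - \<delta> \<le> \<P>(x in P1. \<theta>1 \<in> CI x)"
    and len: "1 - \<delta> \<le> \<P>(x in P0. set_length (CI x) \<le> ereal r)"
  shows "\<bar>\<theta>1 - \<theta>0\<bar> \<le> r"
proof -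
  interpret prob_space P0 by fact
  let ?M = "\<Pi>\<^sub>M i\<in>{..<n}. borel :: real measure"
  have sp: "space P0 = space ?M" "space P1 = space ?M"
    using P0(2) P1 by (auto dest: sets_eq_imp_space_eq)
  have m: "{x \<in> space ?M. \<theta> \<in> CI x} \<in> sets ?M" for \<theta>
    using CI by (simp add: confidence_interval_def Let_def)
  have [measurable]: "(\<lambda>x. set_length (CI x)) \<in> borel_measurable ?M"
    using CI by (simp add: confidence_interval_def Let_def)
  have ml: "{x \<in> space ?M. set_length (CI x) \<le> ereal r} \<in> sets ?M" by measurable
  define A where "A = {x \<in> space P0. \<theta>0 \<in> CI x}"
  define B where "B = {x \<in> space P0. \<theta>1 \<in> CI x}"
  define C where "C = {x \<in> space P0. set_length (CI x) \<le> ereal r}"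
  have ev: "A \<in> events" "B \<in> events" "C \<in> events"
    using m ml by (auto simp: A_def B_def C_def sp P0(2))
  have b: "1 - \<delta> - 1 / 4 \<le> prob B"
    using close[OF m[of \<theta>1]] cov1 by (simp add: B_def sp)
  have "prob (A \<inter> B \<inter> C) > 0"
  proof -
    have "prob (space P0 - (A \<inter> B \<inter> C)) \<le> prob ((space P0 - A) \<union> (space P0 - B) \<union> (space P0 - C))"
      using ev by (intro finite_measure_mono) auto
    also have "\<dots> \<le> prob (space P0 - A) + prob (space P0 - B) + prob (space P0 - C)"
      using ev by (intro order_trans[OF measure_Un_le] add_mono order_refl measure_Un_le) auto
    also have "\<dots> < 1"
      using ev b cov0 len \<open>\<delta> < 1 / 4\<close> by (simp add: prob_compl A_def[symmetric] C_def[symmetric])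
    finally show ?thesis using ev by (simp add: prob_compl)
  qed
  then obtain x where "x \<in> A \<inter> B \<inter> C" by (metis all_not_in_conv measure_empty less_irrefl)
  then have x: "\<theta>1 \<in> CI x" "\<theta>0 \<in> CI x" "set_length (CI x) \<le> ereal r"
    by (auto simp: A_def B_def C_def)
  have "ereal \<bar>\<theta>1 - \<theta>0\<bar> \<le> ereal r"
    by (rule order_trans[OF le_set_length[OF x(1,2)] x(3)])
  then show ?thesis by simp
qed

section \<open>Moment-preserving interpolation at equidistant nodes\<close>

text \<open>
  Both sides are polynomials in \<open>u\<close> of degree below \<open>card J\<close>, and they agree at the \<open>card J\<close>
  nodes.
\<close>

lemma lagrange_interpolation_power:
  fixes x :: "'i \<Rightarrow> real"
  assumes J: "finite J" "inj_on x J" and k: "k < card J"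
  shows "(\<Sum>j\<in>J. (\<Prod>i\<in>J - {j}. (u - x i) / (x j - x i)) * x j ^ k) = u ^ k"
proof -
  define l where "l j = (\<Prod>i\<in>J - {j}. smult (1 / (x j - x i)) [:- x i, 1:])" for j
  define P where "P = (\<Sum>j\<in>J. smult (x j ^ k) (l j))"
  have pl: "poly (l j) y = (\<Prod>i\<in>J - {j}. (y - x i) / (x j - x i))" for j y
    by (simp add: l_def poly_prod diff_divide_distrib)
  have "P = monom 1 k"
  proof (rule poly_eqI_degree[where A = "x ` J"])
    fix y assume "y \<in> x ` J"
    then obtain j where j: "j \<in> J" "y = x j" by auto
    have "poly (l i) (x j) = (if i = j then 1 else 0)" if "i \<in> J" for i
    proof (cases "i = j")
      case True
      then have "poly (l i) (x j) = (\<Prod>i\<in>J - {j}. 1)"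
        unfolding pl using J j by (intro prod.cong) (auto simp: inj_on_def)
      then show ?thesis using True by simp
    next
      case False
      then show ?thesis unfolding pl using J j by (auto intro!: prod_zero)
    qed
    then have "poly P y = (\<Sum>i\<in>J. x i ^ k * (if i = j then 1 else 0))"
      unfolding P_def by (simp add: poly_sum j)
    also have "\<dots> = (\<Sum>i\<in>J. if i = j then x j ^ k else 0)" by (intro sum.cong) auto
    finally show "poly P y = poly (monom 1 k) y" using J j by (simp add: poly_monom)
  next
    have "degree (l j) \<le> card J - 1" if "j \<in> J" for j
    proof -
      have "degree (l j) \<le> (\<Sum>i\<in>J - {j}. degree (smult (1 / (x j - x i)) [:- x i, 1:]))"
        unfolding l_def using J by (intro degree_prod_sum_le[THEN order_trans]) (auto simp: o_def)
      also have "\<dots> \<le> (\<Sum>i\<in>J - {j}. 1)"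
        by (intro sum_mono order_trans[OF degree_smult_le]) simp
      finally show ?thesis using J that by simp
    qed
    then have "degree P \<le> card J - 1" unfolding P_def
      using J by (intro degree_sum_le order_trans[OF degree_smult_le]) auto
    then show "card (x ` J) > degree P" using k by (simp add: card_image J)
    show "card (x ` J) > degree (monom (1::real) k)" using k by (simp add: card_image J degree_monom_eq)
  qed
  then have "poly P u = u ^ k" by (simp add: poly_monom)
  then show ?thesis unfolding P_def by (simp add: poly_sum pl mult.commute)
qed

text \<open>
  The truncated Euler product of \<open>sin (\<pi> u) / (\<pi> u)\<close>. It arises as the even factor of the node
  polynomial of the integers in \<open>[-N, N]\<close>.
\<close>

definition sinc_prod :: "nat \<Rightarrow> real \<Rightarrow> real" where
  "sinc_prod N u = (\<Prod>i=1..N. 1 - u\<^sup>2 / (real i)\<^sup>2)"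

lemma sum_inverse_squares_le: "(\<Sum>i=1..N. 1 / (real i)\<^sup>2) \<le> 2"
proof -
  have "(\<Sum>i=1..Suc N. 1 / (real i)\<^sup>2) \<le> 2 - 1 / real (Suc N)" for N
  proof (induction N)
    case (Suc N)
    define n where "n = real (Suc N)"
    have "0 < n" by (simp add: n_def)
    then have "1 / (n + 1)\<^sup>2 \<le> 1 / (n * (n + 1))"
      by (intro divide_left_mono) (auto simp: power2_eq_square)
    also have "\<dots> = 1 / n - 1 / (n + 1)" using \<open>0 < n\<close> by (simp add: field_simps)
    finally have "1 / (real (Suc (Suc N)))\<^sup>2 \<le> 1 / real (Suc N) - 1 / real (Suc (Suc N))"
      by (simp add: n_def add.commute)
    moreover have "(\<Sum>i=1..Suc (Suc N). 1 / (real i)\<^sup>2) = (\<Sum>i=1..Suc N. 1 / (real i)\<^sup>2) + 1 / (real (Suc (Suc N)))\<^sup>2"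
      by simp
    ultimately show ?case using Suc.IH by linarith
  qed simp
  from this[of "N - 1"] have "(\<Sum>i=1..N. 1 / (real i)\<^sup>2) \<le> 2 - 1 / real N" if "N > 0"
    using that by simp
  then show ?thesis by (cases "N = 0") (auto intro: order_trans)
qed

lemma sinc_prod_bounds:
  assumes "\<bar>u\<bar> \<le> 1 / 2"
  shows "1 / 2 \<le> sinc_prod N u" "sinc_prod N u \<le> 1"
proof -
  have u: "u\<^sup>2 \<le> 1 / 4" using power_mono[OF assms, of 2] by (simp add: power2_eq_square)
  have f: "0 \<le> 1 - u\<^sup>2 / (real i)\<^sup>2" "1 - u\<^sup>2 / (real i)\<^sup>2 \<le> 1" if "i \<ge> 1" for i :: nat
  proof -
    have "u\<^sup>2 / (real i)\<^sup>2 \<le> u\<^sup>2 / 1" using that by (intro divide_left_mono) auto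
    then show "0 \<le> 1 - u\<^sup>2 / (real i)\<^sup>2" using u by simp
  qed simp
  show "sinc_prod N u \<le> 1" unfolding sinc_prod_def using f by (intro prod_le_1) auto
  have "1 - u\<^sup>2 * (\<Sum>i=1..N. 1 / (real i)\<^sup>2) \<le> sinc_prod N u \<and> sinc_prod N u \<le> 1 \<and> 0 \<le> sinc_prod N u"
  proof (induction N)
    case (Suc N)
    have e: "sinc_prod (Suc N) u = sinc_prod N u * (1 - u\<^sup>2 / (real (Suc N))\<^sup>2)" by (simp add: sinc_prod_def)
    have "sinc_prod N u * (u\<^sup>2 / (real (Suc N))\<^sup>2) \<le> 1 * (u\<^sup>2 / (real (Suc N))\<^sup>2)"
      using Suc by (intro mult_right_mono) auto
    then have "1 - u\<^sup>2 * (\<Sum>i=1..Suc N. 1 / (real i)\<^sup>2) \<le> sinc_prod (Suc N) u"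
      using Suc unfolding e by (simp add: algebra_simps)
    moreover have "0 \<le> sinc_prod (Suc N) u" "sinc_prod (Suc N) u \<le> 1"
      unfolding e using Suc f[of "Suc N"] by (auto intro!: mult_nonneg_nonneg mult_le_one simp del: of_nat_Suc)
    ultimately show ?case by simp
  qed (simp add: sinc_prod_def)
  moreover have "u\<^sup>2 * (\<Sum>i=1..N. 1 / (real i)\<^sup>2) \<le> 1 / 4 * 2"
    using u sum_inverse_squares_le[of N]
    by (intro mult_mono) (auto intro!: sum_nonneg)
  ultimately show "1 / 2 \<le> sinc_prod N u" by linarith
qed

lemma nodal_product: "(\<Prod>i\<in>{-int N..int N}. u - of_int i) = u * (-1) ^ N * (fact N)\<^sup>2 * sinc_prod N u"
proof (induction N)
  case (Suc N)
  have s: "{-int (Suc N)..int (Suc N)} = insert (- int (Suc N)) (insert (int (Suc N)) {-int N..int N})"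
    by auto
  have "(u - of_int (- int (Suc N))) * (u - of_int (int (Suc N))) = - ((real (Suc N))\<^sup>2 * (1 - u\<^sup>2 / (real (Suc N))\<^sup>2))"
    by (simp add: power2_eq_square field_simps del: of_nat_Suc)
  then show ?case
    unfolding s by (simp add: Suc sinc_prod_def power_mult_distrib mult.assoc[symmetric] del: of_nat_Suc)
qed (simp add: sinc_prod_def)

text \<open>
  The product is \<open>(N + j)! (N - j)!\<close> in absolute value, so the claim is that the central
  binomial coefficient is the largest of its row.
\<close>

lemma node_distance_product:
  assumes "j \<in> {-int N..int N}"
  shows "(fact N)\<^sup>2 \<le> \<bar>\<Prod>i\<in>{-int N..int N} - {j}. real_of_int j - of_int i\<bar>"
proof -
  define a b where "a = nat (int N + j)" and "b = nat (int N - j)"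
  have ab: "a + b = 2 * N" using assms by (auto simp: a_def b_def)
  have s: "{-int N..int N} - {j} = {-int N..<j} \<union> {j<..int N}" using assms by auto
  have "(\<Prod>i\<in>{-int N..<j}. \<bar>real_of_int j - of_int i\<bar>) = (\<Prod>i\<in>{1..a}. real i)"
    by (rule prod.reindex_bij_witness[of _ "\<lambda>i. j - int i" "\<lambda>i. nat (j - i)"])
       (use assms in \<open>auto simp: a_def\<close>)
  moreover have "(\<Prod>i\<in>{j<..int N}. \<bar>real_of_int j - of_int i\<bar>) = (\<Prod>i\<in>{1..b}. real i)"
    by (rule prod.reindex_bij_witness[of _ "\<lambda>i. j + int i" "\<lambda>i. nat (i - j)"])
       (use assms in \<open>auto simp: b_def\<close>)
  ultimately have "\<bar>\<Prod>i\<in>{-int N..int N} - {j}. real_of_int j - of_int i\<bar> = fact a * fact b"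
    unfolding abs_prod s by (subst prod.union_disjoint) (auto simp: fact_prod)
  moreover have "(fact N)\<^sup>2 \<le> (fact a * fact b :: real)"
  proof -
    let ?C = "real ((2 * N) choose N)"
    have "(fact N)\<^sup>2 * ?C = fact (2 * N)"
      by (simp add: binomial_fact power2_eq_square)
    also have "\<dots> = fact a * fact b * real ((2 * N) choose a)"
    proof -
      have "a \<le> 2 * N" "2 * N - a = b" using ab by auto
      then show ?thesis by (simp add: binomial_fact)
    qed
    also have "\<dots> \<le> fact a * fact b * ?C"
      using binomial_maximum'[of N a] by (intro mult_left_mono) auto
    finally have "(fact N)\<^sup>2 * ?C \<le> (fact a * fact b) * ?C" .
    moreover have "0 < ?C" by simp
    ultimately show ?thesis by (rule mult_right_le_imp_le)
  qed
  ultimately show ?thesis by simp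
qed

text \<open>
  The two atoms at \<open>u\<close> and \<open>- a u\<close> are replaced by weights \<open>c j\<close> at the integers \<open>-N, \<dots>, N\<close> that
  have the same moments of order up to \<open>2 N\<close>. For \<open>j \<noteq> 0\<close> the Lagrange polynomial of node \<open>j\<close>
  takes at \<open>w\<close> the value \<open>A w S(w) / (j - w)\<close>, where \<open>S\<close> is \<open>sinc_prod N\<close> and \<open>\<bar>A\<bar> \<le> 1\<close>. A
  single atom would give weights of order \<open>u / j\<close>, whose sum grows with \<open>N\<close>. The weight \<open>q\<close> is
  chosen so that \<open>p u S(u) = q v S(v)\<close> with \<open>v = a u\<close>: then the leading terms of the two atoms
  cancel and weights of order \<open>u\<^sup>2 / j\<^sup>2\<close> remain, which are summable uniformly in \<open>N\<close>. For \<open>N =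
  0\<close> the same choice of \<open>q\<close> makes the first moment of the two atoms vanish.
\<close>

lemma interpolation_weights:
  fixes p u a :: real and N :: nat
  assumes u: "0 < u" and a: "1 \<le> a" "a * u \<le> 1 / 2" and p: "0 \<le> p" "p \<le> 1"
  obtains q c where "0 \<le> q" "q \<le> 2 * p / a" "N = 0 \<Longrightarrow> q * a = p"
    "\<And>k. k \<le> 2 * N \<Longrightarrow> p * u ^ k + q * (- (a * u)) ^ k = (\<Sum>j\<in>{-int N..int N}. c j * of_int j ^ k)"
    "\<And>j. j \<in> {-int N..int N} - {0} \<Longrightarrow> \<bar>c j\<bar> \<le> 8 * a * u\<^sup>2 / (of_int j)\<^sup>2"
proof -
  define v where "v = a * u"
  have uv: "u \<le> v" "v \<le> 1 / 2" "0 < v" using u a by (auto simp: v_def)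
  note bu = sinc_prod_bounds[of u N] and bv = sinc_prod_bounds[of v N]
  define l where "l j w = (\<Prod>i\<in>{-int N..int N} - {j}. (w - of_int i) / (real_of_int j - of_int i))" for j w
  define q where "q = p * u * sinc_prod N u / (v * sinc_prod N v)"
  define c where "c j = p * l j u + q * l j (- v)" for j
  have ru: "1 / 2 \<le> sinc_prod N u" "sinc_prod N u \<le> 1" "1 / 2 \<le> sinc_prod N v" "sinc_prod N v \<le> 1"
    using bu bv uv u by auto
  have bal: "p * (u * sinc_prod N u) = q * (v * sinc_prod N v)" using ru uv by (simp add: q_def)
  have 1: "0 \<le> q" using p u uv ru by (simp add: q_def)
  have "q = p / a * (sinc_prod N u / sinc_prod N v)" using u a by (simp add: q_def v_def)
  also have "\<dots> \<le> p / a * (1 / (1 / 2))" using p a ru by (intro mult_left_mono frac_le) auto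
  finally have 2: "q \<le> 2 * p / a" by (simp add: mult.commute)
  have 3: "q * a = p" if "N = 0" using that u a by (simp add: q_def v_def sinc_prod_def)
  have 4: "p * u ^ k + q * (- v) ^ k = (\<Sum>j\<in>{-int N..int N}. c j * of_int j ^ k)" if "k \<le> 2 * N" for k
  proof -
    have "(\<Sum>j\<in>{-int N..int N}. l j w * of_int j ^ k) = w ^ k" for w
      unfolding l_def using that
      by (intro lagrange_interpolation_power[where x=real_of_int]) (auto simp: inj_on_def)
    from this[of u] this[of "- v"] show ?thesis
      by (simp add: c_def distrib_right sum.distrib mult.assoc sum_distrib_left[symmetric])
  qed
  have 5: "\<bar>c j\<bar> \<le> 8 * a * u\<^sup>2 / (of_int j)\<^sup>2" if j: "j \<in> {-int N..int N} - {0}" for j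
  proof -
    define D where "D = (\<Prod>i\<in>{-int N..int N} - {j}. real_of_int j - of_int i)"
    define A where "A = - ((-1) ^ N * (fact N)\<^sup>2 / D)"
    have D: "(fact N)\<^sup>2 \<le> \<bar>D\<bar>" using node_distance_product[of j N] j by (simp add: D_def)
    have "0 < \<bar>D\<bar>" by (rule less_le_trans[OF _ D]) simp
    then have A: "\<bar>A\<bar> \<le> 1" using D by (simp add: A_def abs_mult)
    have lj: "l j w = A * (w * sinc_prod N w) / (of_int j - w)" if "w \<noteq> of_int j" for w
    proof -
      have "(\<Prod>i\<in>{-int N..int N}. w - of_int i) = (w - of_int j) * (\<Prod>i\<in>{-int N..int N} - {j}. w - of_int i)"
        using j by (intro prod.remove) auto
      then have "(\<Prod>i\<in>{-int N..int N} - {j}. w - of_int i) = w * (-1) ^ N * (fact N)\<^sup>2 * sinc_prod N w / (w - of_int j)"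
        using that by (simp add: nodal_product field_simps)
      then have "l j w = w * (-1) ^ N * (fact N)\<^sup>2 * sinc_prod N w / (w - of_int j) / D"
        by (simp add: l_def prod_dividef D_def)
      then show ?thesis using that \<open>0 < \<bar>D\<bar>\<close> by (simp add: A_def field_simps)
    qed
    have ge: "1 \<le> \<bar>real_of_int j\<bar>" using j by auto
    then have du: "\<bar>real_of_int j\<bar> / 2 \<le> \<bar>of_int j - u\<bar>" "\<bar>real_of_int j\<bar> / 2 \<le> \<bar>of_int j + v\<bar>"
      using u uv by linarith+
    then have ne: "of_int j - u \<noteq> 0" "of_int j + v \<noteq> 0" using ge by auto
    define m where "m = p * (u * sinc_prod N u)"
    have "0 \<le> p * sinc_prod N u" "p * sinc_prod N u \<le> 1"
      using p ru by (auto intro: mult_le_one)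
    then have m: "0 \<le> m" "m \<le> u"
      unfolding m_def using mult_left_mono[of "p * sinc_prod N u" 1 u] mult_nonneg_nonneg[of u "p * sinc_prod N u"] u
      by (auto simp: mult_ac)
    have lv: "l j (- v) = - (A * (v * sinc_prod N v) / (of_int j + v))"
      using lj[of "- v"] ne by (simp add: sinc_prod_def)
    have "c j = A * (p * (u * sinc_prod N u)) / (of_int j - u) - A * (q * (v * sinc_prod N v)) / (of_int j + v)"
      using lj[of u] lv ne by (simp add: c_def mult_ac)
    also have "\<dots> = A * m / (of_int j - u) - A * m / (of_int j + v)"
      by (simp only: bal[symmetric] m_def)
    also have "\<dots> = A * m * ((u + v) / ((of_int j - u) * (of_int j + v)))"
      using ne by (simp add: diff_frac_eq right_diff_distrib[symmetric])
    finally have "\<bar>c j\<bar> = \<bar>A\<bar> * m * ((u + v) / (\<bar>of_int j - u\<bar> * \<bar>of_int j + v\<bar>))"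
      using m u uv by (simp add: abs_mult)
    also have "\<dots> \<le> 1 * u * ((2 * v) / ((\<bar>of_int j\<bar> / 2) * (\<bar>of_int j\<bar> / 2)))"
    proof (intro mult_mono frac_le)
      have "real_of_int j \<noteq> 0" using j by simp
      then show "0 < \<bar>real_of_int j\<bar> / 2 * (\<bar>real_of_int j\<bar> / 2)" by (intro mult_pos_pos) auto
    qed (use A m u uv du in auto)
    also have "\<dots> = 8 * a * u\<^sup>2 / (of_int j)\<^sup>2"
      by (simp add: v_def power2_eq_square)
    finally show ?thesis .
  qed
  show thesis using that[of q c] 1 2 3 4 5 by (simp add: v_def)
qed

text \<open>
  Expanding the exponential turns the form into the sum of \<open>\<mu> k\<^sup>2 / k!\<close> over the moments \<open>\<mu> k\<close>
  of the signed weights. The moments below \<open>m\<close> vanish and the others are at most \<open>b M\<^sup>k\<close>; the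
  tail of the exponential series is then bounded by multiplying its terms with \<open>exp (2 (k - m))
  \<ge> 1\<close> and summing over all \<open>k\<close>.
\<close>

lemma exponential_form_le:
  fixes d x :: "'i \<Rightarrow> real"
  assumes I: "finite I" and M: "0 < M" "\<And>i. i \<in> I \<Longrightarrow> \<bar>x i\<bar> \<le> M"
    and mom: "\<And>k. k < m \<Longrightarrow> (\<Sum>i\<in>I. d i * x i ^ k) = 0" and m: "2 \<le> m"
    and b: "(\<Sum>i\<in>I. \<bar>d i\<bar> * (x i)\<^sup>2) \<le> b * M\<^sup>2"
  shows "(\<Sum>i\<in>I. \<Sum>j\<in>I. d i * d j * exp (x i * x j)) \<le> b\<^sup>2 * exp (exp 2 * M\<^sup>2 - 2 * real m)"
proof -
  have "(\<lambda>k. \<Sum>i\<in>I. \<Sum>j\<in>I. d i * d j * ((x i * x j) ^ k /\<^sub>R fact k)) sums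
      (\<Sum>i\<in>I. \<Sum>j\<in>I. d i * d j * exp (x i * x j))"
    by (intro sums_sum sums_mult exp_converges)
  moreover have "(\<Sum>i\<in>I. \<Sum>j\<in>I. d i * d j * ((x i * x j) ^ k /\<^sub>R fact k)) = (\<Sum>i\<in>I. d i * x i ^ k)\<^sup>2 / fact k" for k
    unfolding power2_eq_square sum_product sum_divide_distrib
    by (intro sum.cong refl) (simp add: power_mult_distrib field_simps)
  ultimately have S: "(\<lambda>k. (\<Sum>i\<in>I. d i * x i ^ k)\<^sup>2 / fact k) sums
      (\<Sum>i\<in>I. \<Sum>j\<in>I. d i * d j * exp (x i * x j))" by simp
  have T: "(\<lambda>k. (b\<^sup>2 * exp (- 2 * real m)) * ((exp 2 * M\<^sup>2) ^ k /\<^sub>R fact k)) sums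
      ((b\<^sup>2 * exp (- 2 * real m)) * exp (exp 2 * M\<^sup>2))"
    by (intro sums_mult exp_converges)
  have "(\<Sum>i\<in>I. d i * x i ^ k)\<^sup>2 / fact k \<le> (b\<^sup>2 * exp (- 2 * real m)) * ((exp 2 * M\<^sup>2) ^ k /\<^sub>R fact k)" for k
  proof (cases "k < m")
    case True
    then show ?thesis using M by (simp add: mom)
  next
    case False
    then obtain l where l: "k = l + 2" using m by (metis add.commute le_Suc_ex not_less order_trans)
    have "\<bar>\<Sum>i\<in>I. d i * x i ^ k\<bar> \<le> (\<Sum>i\<in>I. (\<bar>d i\<bar> * (x i)\<^sup>2) * M ^ l)"
    proof (intro order_trans[OF sum_abs] sum_mono)
      fix i assume "i \<in> I"
      have "\<bar>d i * x i ^ k\<bar> = (\<bar>d i\<bar> * (x i)\<^sup>2) * \<bar>x i\<bar> ^ l"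
        by (simp add: l abs_mult power_add power_abs power2_eq_square mult_ac)
      also have "\<dots> \<le> (\<bar>d i\<bar> * (x i)\<^sup>2) * M ^ l"
        using M \<open>i \<in> I\<close> by (intro mult_left_mono power_mono) auto
      finally show "\<bar>d i * x i ^ k\<bar> \<le> (\<bar>d i\<bar> * (x i)\<^sup>2) * M ^ l" .
    qed
    also have "\<dots> \<le> b * M\<^sup>2 * M ^ l"
      unfolding sum_distrib_right[symmetric] using b M by (intro mult_right_mono) auto
    finally have "\<bar>\<Sum>i\<in>I. d i * x i ^ k\<bar> \<le> b * M ^ k" by (simp add: l power_add mult_ac power2_eq_square)
    then have "(\<Sum>i\<in>I. d i * x i ^ k)\<^sup>2 \<le> (b * M ^ k)\<^sup>2"
      by (metis abs_ge_zero power2_abs power_mono)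
    also have "\<dots> = b\<^sup>2 * (M\<^sup>2) ^ k * 1"
      by (simp add: power_mult_distrib power_mult[symmetric] mult.commute)
    also have "\<dots> \<le> b\<^sup>2 * (M\<^sup>2) ^ k * exp (2 * real k - 2 * real m)"
      using False by (intro mult_left_mono) auto
    also have "\<dots> = (b\<^sup>2 * exp (- 2 * real m)) * (exp 2 * M\<^sup>2) ^ k"
    proof -
      have "exp (2 * real k - 2 * real m) = exp (- 2 * real m) * exp 2 ^ k"
        by (simp add: exp_of_nat_mult[symmetric] mult_exp_exp algebra_simps)
      then show ?thesis by (simp add: power_mult_distrib mult_ac)
    qed
    finally show ?thesis by (simp add: divide_simps)
  qed
  from sums_le[OF this S T] show ?thesis
    by (simp add: mult.assoc mult_exp_exp)
qed

section \<open>Hard pairs of hypotheses\<close>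

text \<open>
  Signed weights \<open>d\<close> yield a hard pair of hypotheses: the positive part of \<open>d\<close> becomes the
  mixture with contamination level \<open>\<epsilon>max\<close> and null mean \<open>\<sigma> x l\<close>, the negative part the one with
  contamination level \<open>\<epsilon>\<close> and null mean \<open>0\<close>, and the mass missing to one is added to both at the
  origin, where it does not alter their difference. Coverage enters at both contamination
  levels, the interval length at level \<open>\<epsilon>\<close>: this is the price of not knowing \<open>\<epsilon>\<close>.
\<close>

lemma nearly_null_bound:
  fixes x d :: "'i \<Rightarrow> real" and r :: "real \<Rightarrow> real"
  assumes CI: "confidence_interval n CI" and \<delta>: "\<delta> < 1 / 4" and \<epsilon>max: "\<epsilon>max < 1 / 2" and \<sigma>: "0 < \<sigma>"
    and cov: "\<forall>\<theta>. \<forall>\<epsilon>\<in>{0..\<epsilon>max}. \<forall>Q\<in>space (prob_algebra borel).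
      1 - \<delta> \<le> \<P>(x in two_groups_iid n \<theta> \<sigma> \<epsilon> Q. \<theta> \<in> CI x)"
    and len: "\<forall>\<theta>. \<forall>\<epsilon>\<in>{0..\<epsilon>max}. \<forall>Q\<in>space (prob_algebra borel).
      1 - \<delta> \<le> \<P>(x in two_groups_iid n \<theta> \<sigma> \<epsilon> Q. set_length (CI x) \<le> ereal (r \<epsilon>))"
    and I: "finite I" "k \<in> I" "x k = 0" "l \<in> I" and \<epsilon>: "\<epsilon> \<in> {0..\<epsilon>max}"
    and d: "sum d I = 0" "(\<Sum>i\<in>I. max (d i) 0) \<le> 1" "1 - \<epsilon>max \<le> d l" "(\<Sum>i\<in>I - {k}. max (- d i) 0) \<le> \<epsilon>"
    and chi: "real n * (\<Sum>i\<in>I. \<Sum>j\<in>I. d i * d j * exp (x i * x j)) \<le> 1 / 40"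
  shows "\<sigma> * \<bar>x l\<bar> \<le> r \<epsilon>"
proof -
  define pad where "pad = 1 - (\<Sum>i\<in>I. max (d i) 0)"
  define g0 where "g0 i = max (- d i) 0 + (if i = k then pad else 0)" for i
  define g1 where "g1 i = max (d i) 0 + (if i = k then pad else 0)" for i
  have pad: "0 \<le> pad" using d(2) by (simp add: pad_def)
  have diff: "g1 i - g0 i = d i" for i by (simp add: g0_def g1_def max_def)
  have nn: "0 \<le> g0 i" "0 \<le> g1 i" for i using pad by (auto simp: g0_def g1_def)
  have s1: "sum g1 I = 1" using I by (simp add: g1_def sum.distrib pad_def)
  have "sum g1 I - sum g0 I = 0" using d(1) by (simp add: sum_subtractf[symmetric] diff)
  then have s0: "sum g0 I = 1" using s1 by simp
  have "sum g0 I = g0 k + sum g0 (I - {k})" using I by (simp add: sum.remove)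
  moreover have "sum g0 (I - {k}) = (\<Sum>i\<in>I - {k}. max (- d i) 0)"
    by (intro sum.cong) (auto simp: g0_def)
  ultimately have k0: "1 - \<epsilon> \<le> g0 k" using s0 d(4) by simp
  have l1: "1 - \<epsilon>max \<le> g1 l" using d(3) pad by (auto simp: g1_def)
  have e: "0 \<le> \<epsilon>" "\<epsilon> \<le> 1" "0 \<le> \<epsilon>max" "\<epsilon>max \<le> 1" "\<epsilon>max \<in> {0..\<epsilon>max}" using \<epsilon> \<epsilon>max by auto
  obtain Q0 where Q0: "Q0 \<in> space (prob_algebra borel)"
    "two_groups (\<sigma> * x k) \<sigma> \<epsilon> Q0 = density lborel (gaussian_mixture I x g0 \<sigma>)"
    using two_groups_eq_mixture[where I=I and k=k and g=g0 and x=x, OF I(1,2) nn(1) s0 k0 \<sigma> e(1,2)] by auto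
  obtain Q1 where Q1: "Q1 \<in> space (prob_algebra borel)"
    "two_groups (\<sigma> * x l) \<sigma> \<epsilon>max Q1 = density lborel (gaussian_mixture I x g1 \<sigma>)"
    using two_groups_eq_mixture[where I=I and k=l and g=g1 and x=x, OF I(1,4) nn(2) s1 l1 \<sigma> e(3,4)] by auto
  have sets: "sets (two_groups_iid n \<theta> \<sigma> \<epsilon> Q) = sets (\<Pi>\<^sub>M i\<in>{..<n}. borel)" for \<theta> \<epsilon> Q
    unfolding two_groups_iid_def by (intro sets_PiM_cong) auto
  have "\<bar>\<sigma> * x l - 0\<bar> \<le> r \<epsilon>"
  proof (rule two_point_bound[OF CI \<delta>])
    show "prob_space (two_groups_iid n 0 \<sigma> \<epsilon> Q0)"
      unfolding two_groups_iid_def using prob_space_two_groups[OF \<sigma> e(1,2) Q0(1)]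
      by (intro prob_space_PiM) auto
    show "1 - \<delta> \<le> \<P>(x in two_groups_iid n 0 \<sigma> \<epsilon> Q0. 0 \<in> CI x)" using cov \<epsilon> Q0(1) by blast
    show "1 - \<delta> \<le> \<P>(y in two_groups_iid n (\<sigma> * x l) \<sigma> \<epsilon>max Q1. \<sigma> * x l \<in> CI y)"
      using cov e(5) Q1(1) by blast
    show "1 - \<delta> \<le> \<P>(x in two_groups_iid n 0 \<sigma> \<epsilon> Q0. set_length (CI x) \<le> ereal (r \<epsilon>))"
      using len \<epsilon> Q0(1) by blast
    fix B :: "(nat \<Rightarrow> real) set" assume B: "B \<in> sets (\<Pi>\<^sub>M i\<in>{..<n}. borel)"
    have "1 / 2 \<le> g0 k" using k0 \<epsilon> \<epsilon>max by auto
    from iid_mixtures_close[where I=I and k=k and x=x and ?g0.0=g0 and ?g1.0=g1 and n=n,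
      OF I(1-3) \<sigma> nn(1) s0 this nn(2) s1 _ B]
    show "measure (two_groups_iid n (\<sigma> * x l) \<sigma> \<epsilon>max Q1) B \<le> measure (two_groups_iid n 0 \<sigma> \<epsilon> Q0) B + 1 / 4"
      using chi Q0(2) Q1(2) I(3) by (simp add: two_groups_iid_def diff)
  qed (rule sets)+
  then show ?thesis using \<sigma> by (simp add: abs_mult)
qed

text \<open>
  The signed weights are \<open>1 - \<epsilon>max\<close> at \<open>h u\<close>, the balancing weight \<open>q\<close> at \<open>- h a u\<close>, and the
  negatives of the interpolation weights at the nodes \<open>h j\<close>, \<open>\<bar>j\<bar> \<le> N\<close>. The indices \<open>N + 1\<close> and
  \<open>N + 2\<close> carry the two atoms. The value \<open>a = 4 / \<epsilon>max\<close> makes \<open>q \<le> \<epsilon>max / 2\<close>, which leaves mass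
  \<open>\<epsilon>max / 2\<close> for the nodes. Away from the origin the negative part has mass of order \<open>u\<^sup>2\<close> only,
  although the dominant atom has moved by \<open>h u\<close>. The number of vanishing moments is \<open>2 N + 1\<close>,
  and \<open>2\<close> if \<open>N = 0\<close>.
\<close>

lemma moment_matching_perturbation:
  fixes \<epsilon>max u h :: real and N :: nat
  defines "a \<equiv> 4 / \<epsilon>max" and "I \<equiv> {-int N..int N + 2}" and "M \<equiv> h * real (max 1 N)"
  assumes \<epsilon>max: "0 < \<epsilon>max" "\<epsilon>max < 1 / 2" and u: "0 < u" "a * u \<le> 1 / 2" and h: "0 < h"
  obtains x d :: "int \<Rightarrow> real" where "x 0 = 0" "x (int N + 1) = h * u" "d (int N + 1) = 1 - \<epsilon>max"
    "sum d I = 0" "(\<Sum>i\<in>I. max (d i) 0) \<le> 1 - \<epsilon>max / 2 + 32 * a * u\<^sup>2"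
    "(\<Sum>i\<in>I - {0}. max (- d i) 0) \<le> (if N = 0 then 0 else 32 * a * u\<^sup>2)"
    "(\<Sum>i\<in>I. \<Sum>j\<in>I. d i * d j * exp (x i * x j))
      \<le> (35 * a * u\<^sup>2)\<^sup>2 * exp (exp 2 * M\<^sup>2 - 2 * max 2 (2 * real N + 1))"
proof -
  define p where "p = 1 - \<epsilon>max"
  have a: "8 < a" using \<epsilon>max by (simp add: a_def field_simps)
  have p: "0 \<le> p" "p \<le> 1" using \<epsilon>max by (auto simp: p_def)
  define J where "J = {-int N..int N}"
  obtain q c where q: "0 \<le> q" "q \<le> 2 * p / a" "N = 0 \<Longrightarrow> q * a = p"
    and c: "\<And>k. k \<le> 2 * N \<Longrightarrow> p * u ^ k + q * (- (a * u)) ^ k = (\<Sum>j\<in>J. c j * of_int j ^ k)"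
      "\<And>j. j \<in> J - {0} \<Longrightarrow> \<bar>c j\<bar> \<le> 8 * a * u\<^sup>2 / (of_int j)\<^sup>2"
    unfolding J_def
    by (rule interpolation_weights[of u a p N]) (use u a p in auto)
  define y where "y i = (if i = int N + 1 then u else if i = int N + 2 then - (a * u) else of_int i)" for i
  define x where "x i = h * y i" for i
  define d where "d i = (if i = int N + 1 then p else if i = int N + 2 then q else - c i)" for i
  have I: "I = insert (int N + 1) (insert (int N + 2) J)" by (auto simp: I_def J_def)
  have J: "finite J" "int N + 1 \<notin> J" "int N + 2 \<notin> J" "0 \<in> J" by (auto simp: J_def)
  have sumI: "sum f I = f (int N + 1) + f (int N + 2) + sum f J" for f :: "int \<Rightarrow> real"
    unfolding I using J by simp
  have sumI0: "sum f (I - {0}) = f (int N + 1) + f (int N + 2) + sum f (J - {0})" for f :: "int \<Rightarrow> real"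
  proof -
    have "I - {0} = insert (int N + 1) (insert (int N + 2) (J - {0}))" unfolding I by auto
    then show ?thesis using J by simp
  qed
  have yd [simp]: "y (int N + 1) = u" "y (int N + 2) = - (a * u)" "d (int N + 1) = p" "d (int N + 2) = q"
    by (auto simp: y_def d_def)
  have ydJ: "y j = of_int j" "d j = - c j" if "j \<in> J" for j
    using that by (auto simp: y_def d_def J_def)
  have momy: "(\<Sum>i\<in>I. d i * y i ^ k) = 0" if "k < max 2 (2 * N + 1)" for k
  proof (cases "k \<le> 2 * N")
    case True
    have "(\<Sum>j\<in>J. d j * y j ^ k) = - (\<Sum>j\<in>J. c j * of_int j ^ k)"
      unfolding sum_negf[symmetric] by (intro sum.cong) (auto simp: ydJ)
    then show ?thesis using c(1)[OF True] by (simp add: sumI)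
  next
    case False
    with that have "N = 0" "k = 1" by (auto simp: max_def split: if_splits)
    then have "(\<Sum>j\<in>J. d j * y j ^ k) = 0" by (simp add: J_def y_def)
    then have "(\<Sum>i\<in>I. d i * y i ^ k) = p * u + q * (- (a * u))"
      unfolding sumI yd using \<open>k = 1\<close> by simp
    then show ?thesis using q(3)[OF \<open>N = 0\<close>] by simp
  qed
  have mom: "(\<Sum>i\<in>I. d i * x i ^ k) = 0" if "k < max 2 (2 * N + 1)" for k
  proof -
    have "(\<Sum>i\<in>I. d i * x i ^ k) = h ^ k * (\<Sum>i\<in>I. d i * y i ^ k)"
      by (simp add: x_def power_mult_distrib sum_distrib_left mult_ac)
    then show ?thesis using momy[OF that] by simp
  qed
  have sumc: "(\<Sum>j\<in>J - {0}. \<bar>c j\<bar>) \<le> (if N = 0 then 0 else 32 * a * u\<^sup>2)"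
  proof (cases "N = 0")
    case True then show ?thesis by (simp add: J_def)
  next
    case False
    have e: "J - {0} = (\<lambda>i. int i) ` {1..N} \<union> (\<lambda>i. - int i) ` {1..N}"
    proof (intro set_eqI iffI)
      fix j assume "j \<in> J - {0}"
      then have "j = int (nat \<bar>j\<bar>) \<or> j = - int (nat \<bar>j\<bar>)" "nat \<bar>j\<bar> \<in> {1..N}" by (auto simp: J_def)
      then show "j \<in> (\<lambda>i. int i) ` {1..N} \<union> (\<lambda>i. - int i) ` {1..N}" by blast
    qed (auto simp: J_def)
    have "(\<Sum>j\<in>J - {0}. 1 / (real_of_int j)\<^sup>2) = (\<Sum>i=1..N. 1 / (real i)\<^sup>2) + (\<Sum>i=1..N. 1 / (real i)\<^sup>2)"
      unfolding e by (subst sum.union_disjoint) (auto simp: sum.reindex inj_on_def)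
    then have S: "(\<Sum>j\<in>J - {0}. 1 / (real_of_int j)\<^sup>2) \<le> 4" using sum_inverse_squares_le[of N] by simp
    have "(\<Sum>j\<in>J - {0}. \<bar>c j\<bar>) \<le> (\<Sum>j\<in>J - {0}. 8 * a * u\<^sup>2 * (1 / (real_of_int j)\<^sup>2))"
      using c(2) by (intro sum_mono) simp
    also have "\<dots> \<le> 8 * a * u\<^sup>2 * 4"
      unfolding sum_distrib_left[symmetric] using a S by (intro mult_left_mono) auto
    finally show ?thesis using False by simp
  qed
  have pq: "p + q \<le> 1 - \<epsilon>max / 2"
  proof -
    have "q \<le> 2 * 1 / a" using q(2) divide_right_mono[of "2 * p" 2 a] p a by simp
    then show ?thesis using \<epsilon>max by (simp add: a_def p_def)
  qed
  have sum0: "sum d I = 0" using momy[of 0] by simp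
  have sumc': "(\<Sum>j\<in>J - {0}. \<bar>c j\<bar>) \<le> 32 * a * u\<^sup>2"
    by (rule order_trans[OF sumc]) (use a in simp)
  have posp: "(\<Sum>i\<in>I. max (d i) 0) \<le> 1 - \<epsilon>max / 2 + 32 * a * u\<^sup>2"
  proof -
    \<comment> \<open>Equality of the total masses controls the weight of the node at the origin.\<close>
    have "p + q = c 0 + (\<Sum>j\<in>J - {0}. c j)"
      using c(1)[of 0] J by (simp add: sum.remove[of J 0 c])
    moreover have "(\<Sum>j\<in>J - {0}. c j) \<le> (\<Sum>j\<in>J - {0}. max (c j) 0)" by (intro sum_mono) auto
    moreover have "0 \<le> (\<Sum>j\<in>J - {0}. max (c j) 0)" by (intro sum_nonneg) auto
    ultimately have c0: "max (- c 0) 0 \<le> (\<Sum>j\<in>J - {0}. max (c j) 0)" using p q(1) by linarith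
    have "(\<Sum>j\<in>J. max (d j) 0) = max (- c 0) 0 + (\<Sum>j\<in>J - {0}. max (- c j) 0)"
      using J by (simp add: sum.remove[of J 0] ydJ)
    also have "\<dots> \<le> (\<Sum>j\<in>J - {0}. max (c j) 0 + max (- c j) 0)" using c0 by (simp add: sum.distrib)
    also have "\<dots> = (\<Sum>j\<in>J - {0}. \<bar>c j\<bar>)" by (intro sum.cong) auto
    finally have "(\<Sum>j\<in>J. max (d j) 0) \<le> 32 * a * u\<^sup>2" using sumc' by linarith
    then show ?thesis using p q(1) pq by (simp add: sumI)
  qed
  have negp: "(\<Sum>i\<in>I - {0}. max (- d i) 0) \<le> (if N = 0 then 0 else 32 * a * u\<^sup>2)"
  proof -
    have "(\<Sum>i\<in>I - {0}. max (- d i) 0) = (\<Sum>j\<in>J - {0}. max (c j) 0)"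
      using p q(1) by (simp add: sumI0 ydJ)
    also have "\<dots> \<le> (\<Sum>j\<in>J - {0}. \<bar>c j\<bar>)" by (intro sum_mono) auto
    finally show ?thesis using sumc by linarith
  qed
  have M: "0 < M" "h \<le> M" using h by (auto simp: M_def)
  have xM: "\<bar>x i\<bar> \<le> M" if "i \<in> I" for i
  proof -
    have "\<bar>y i\<bar> \<le> real (max 1 N)"
    proof -
      have "u \<le> a * u" using mult_right_mono[of 1 a u] u a by simp
      moreover have "1 \<le> real (max 1 N)" by simp
      moreover have "\<bar>y i\<bar> = u \<or> \<bar>y i\<bar> = a * u \<or> \<bar>y i\<bar> \<le> real (max 1 N)"
      proof (cases "i \<in> J")
        case True
        then have "\<bar>real_of_int i\<bar> \<le> real N" by (auto simp: J_def)
        also have "\<dots> \<le> real (max 1 N)" by simp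
        finally show ?thesis unfolding ydJ(1)[OF True] by blast
      next
        case False
        then show ?thesis using that u a by (auto simp: I y_def abs_mult)
      qed
      ultimately show ?thesis using u by linarith
    qed
    then show ?thesis using h by (simp add: x_def M_def abs_mult)
  qed
  have B: "(\<Sum>i\<in>I. \<bar>d i\<bar> * (x i)\<^sup>2) \<le> (35 * a * u\<^sup>2) * M\<^sup>2"
  proof -
    have "(\<Sum>j\<in>J. \<bar>d j\<bar> * (x j)\<^sup>2) = (\<Sum>j\<in>J - {0}. \<bar>c j\<bar> * (x j)\<^sup>2)"
      using J by (simp add: sum.remove[of J 0] ydJ x_def)
    also have "\<dots> \<le> (\<Sum>j\<in>J - {0}. \<bar>c j\<bar> * M\<^sup>2)"
    proof (intro sum_mono mult_left_mono)
      fix j assume "j \<in> J - {0}"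
      then show "(x j)\<^sup>2 \<le> M\<^sup>2" using power_mono[OF xM[of j], of 2] by (simp add: I)
    qed simp
    also have "\<dots> \<le> 32 * a * u\<^sup>2 * M\<^sup>2"
      unfolding sum_distrib_right[symmetric] using sumc' by (intro mult_right_mono) auto
    finally have 1: "(\<Sum>j\<in>J. \<bar>d j\<bar> * (x j)\<^sup>2) \<le> 32 * a * u\<^sup>2 * M\<^sup>2" .
    have "q * a \<le> 2" using q(2) p a by (simp add: field_simps)
    then have "q * a * a \<le> 2 * a" using a by (intro mult_right_mono) auto
    then have "(p + q * a * a) * (u\<^sup>2 * h\<^sup>2) \<le> (a + 2 * a) * (u\<^sup>2 * M\<^sup>2)"
      using p a M h q u by (intro mult_mono add_mono power_mono) auto
    then have 2: "p * (h * u)\<^sup>2 + q * (h * (a * u))\<^sup>2 \<le> 3 * a * u\<^sup>2 * M\<^sup>2"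
      by (simp add: power2_eq_square algebra_simps)
    show ?thesis using 1 2 p q(1) by (simp add: sumI x_def power_mult_distrib)
  qed
  have "(\<Sum>i\<in>I. \<Sum>j\<in>I. d i * d j * exp (x i * x j))
    \<le> (35 * a * u\<^sup>2)\<^sup>2 * exp (exp 2 * M\<^sup>2 - 2 * real (max 2 (2 * N + 1)))"
    by (rule exponential_form_le[OF _ M(1) xM mom _ B]) (auto simp: I J)
  also have "real (max 2 (2 * N + 1)) = max 2 (2 * real N + 1)" by (simp add: of_nat_max)
  finally have E: "(\<Sum>i\<in>I. \<Sum>j\<in>I. d i * d j * exp (x i * x j))
    \<le> (35 * a * u\<^sup>2)\<^sup>2 * exp (exp 2 * M\<^sup>2 - 2 * max 2 (2 * real N + 1))" .
  show thesis
    by (rule that[of x d]) (use sum0 posp negp E in \<open>simp_all add: x_def y_def p_def\<close>)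
qed

section \<open>The lower bound\<close>

lemma cINF_ge_imp_all:
  fixes f :: "real \<Rightarrow> real \<Rightarrow> 'q \<Rightarrow> real"
  assumes "(INF \<theta>. INF (\<epsilon>, Q)\<in>A \<times> B. f \<theta> \<epsilon> Q) \<ge> c" and "\<And>\<theta> \<epsilon> Q. 0 \<le> f \<theta> \<epsilon> Q"
  shows "\<forall>\<theta>. \<forall>\<epsilon>\<in>A. \<forall>Q\<in>B. c \<le> f \<theta> \<epsilon> Q"
proof (intro allI ballI)
  fix \<theta> \<epsilon> Q assume "\<epsilon> \<in> A" "Q \<in> B"
  let ?g = "\<lambda>\<theta>. INF (\<epsilon>, Q)\<in>A \<times> B. f \<theta> \<epsilon> Q"
  have "0 \<le> ?g \<theta>" for \<theta> using assms(2) \<open>\<epsilon> \<in> A\<close> \<open>Q \<in> B\<close> by (intro cINF_greatest) auto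
  then have "(INF \<theta>. ?g \<theta>) \<le> ?g \<theta>" by (intro cINF_lower) (auto intro!: bdd_belowI[of _ 0])
  also have "\<dots> \<le> (case (\<epsilon>, Q) of (\<epsilon>, Q) \<Rightarrow> f \<theta> \<epsilon> Q)"
    using assms(2) \<open>\<epsilon> \<in> A\<close> \<open>Q \<in> B\<close> by (intro cINF_lower) (auto intro!: bdd_belowI[of _ 0])
  finally show "c \<le> f \<theta> \<epsilon> Q" using assms(1) by simp
qed

text \<open>
  For the first bound \<open>N = 0\<close>: only mean and mass are matched, the quadratic form is of order
  \<open>u\<^sup>4\<close>, and \<open>u\<close> of order \<open>n\<^sup>-\<^sup>1\<^sup>/\<^sup>4\<close> is admissible at every \<open>\<epsilon>\<close>. For the second bound \<open>u\<close> is of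
  order \<open>\<surd>\<epsilon>\<close>, as large as the contamination budget permits. The factor \<open>\<epsilon>\<^sup>2\<close> in the quadratic
  form then has to be reduced to \<open>1 / n\<close> by matching \<open>2 N \<ge> ln (n \<epsilon>\<^sup>2)\<close> moments. The nodes must
  stay within a radius of order \<open>\<surd>N\<close>, because the tail \<open>k > 2 N\<close> of the series of \<open>M\<^sup>2\<^sup>k / k!\<close>
  is exponentially small in \<open>N\<close> only for such radii \<open>M\<close>, so their spacing \<open>h\<close> is of order \<open>1 /
  \<surd>N\<close>, and the shift is \<open>h u\<close>.
\<close>

lemma adaptive_length_bound:
  fixes r :: "real \<Rightarrow> real"
  assumes CI: "confidence_interval n CI" and \<delta>: "\<delta> < 1 / 4" and \<epsilon>max: "0 < \<epsilon>max" "\<epsilon>max < 1 / 2"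
    and \<sigma>: "0 < \<sigma>" and n: "1 \<le> n"
    and cov: "\<forall>\<theta>. \<forall>\<epsilon>\<in>{0..\<epsilon>max}. \<forall>Q\<in>space (prob_algebra borel).
      1 - \<delta> \<le> \<P>(x in two_groups_iid n \<theta> \<sigma> \<epsilon> Q. \<theta> \<in> CI x)"
    and len: "\<forall>\<theta>. \<forall>\<epsilon>\<in>{0..\<epsilon>max}. \<forall>Q\<in>space (prob_algebra borel).
      1 - \<delta> \<le> \<P>(x in two_groups_iid n \<theta> \<sigma> \<epsilon> Q. set_length (CI x) \<le> ereal (r \<epsilon>))"
    and \<epsilon>: "\<epsilon> \<in> {0..\<epsilon>max}"
  defines "a \<equiv> 4 / \<epsilon>max"
  shows "\<sigma> / (64 * a) * (1 / real n powr (1 / 4)) \<le> r \<epsilon>" (is ?parametric)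
    and "1 \<le> real n * \<epsilon>\<^sup>2 \<Longrightarrow>
      \<sigma> / (64 * a) * (sqrt \<epsilon> / sqrt (max 1 (ln (exp 1 * real n * \<epsilon>\<^sup>2)))) \<le> r \<epsilon>" (is "_ \<Longrightarrow> ?contaminated")
proof -
  have a: "8 < a" "a * \<epsilon>max = 4" using \<epsilon>max by (auto simp: a_def field_simps)
  have exp2: "exp 2 \<le> (9 :: real)"
  proof -
    have "exp 2 = exp 1 * (exp 1 :: real)" by (simp only: mult_exp_exp one_add_one)
    also have "\<dots> \<le> 3 * 3" by (intro mult_mono exp_le) auto
    finally show ?thesis by simp
  qed
  have bound: "\<sigma> * (h * u) \<le> r \<epsilon>"
    if u: "0 < u" "a * u \<le> 1 / 2" and h: "0 < h"
      and small: "32 * a * u\<^sup>2 \<le> \<epsilon>max / 2" "N = 0 \<or> 32 * a * u\<^sup>2 \<le> \<epsilon>"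
      and chi: "real n * ((35 * a * u\<^sup>2)\<^sup>2 * exp (exp 2 * (h * real (max 1 N))\<^sup>2 - 2 * max 2 (2 * real N + 1))) \<le> 1 / 40"
    for h u N
  proof -
    obtain x d :: "int \<Rightarrow> real" where xd: "x 0 = 0" "x (int N + 1) = h * u" "d (int N + 1) = 1 - \<epsilon>max"
      "sum d {-int N..int N + 2} = 0"
      "(\<Sum>i\<in>{-int N..int N + 2}. max (d i) 0) \<le> 1 - \<epsilon>max / 2 + 32 * a * u\<^sup>2"
      "(\<Sum>i\<in>{-int N..int N + 2} - {0}. max (- d i) 0) \<le> (if N = 0 then 0 else 32 * a * u\<^sup>2)"
      "(\<Sum>i\<in>{-int N..int N + 2}. \<Sum>j\<in>{-int N..int N + 2}. d i * d j * exp (x i * x j))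
        \<le> (35 * a * u\<^sup>2)\<^sup>2 * exp (exp 2 * (h * real (max 1 N))\<^sup>2 - 2 * max 2 (2 * real N + 1))"
      by (rule moment_matching_perturbation[of \<epsilon>max u h N, folded a_def, OF \<epsilon>max u h])
    have "\<sigma> * \<bar>x (int N + 1)\<bar> \<le> r \<epsilon>"
    proof (rule nearly_null_bound[OF CI \<delta> \<epsilon>max(2) \<sigma> cov len, where I="{-int N..int N + 2}" and k=0 and d=d])
      show "real n * (\<Sum>i\<in>{-int N..int N + 2}. \<Sum>j\<in>{-int N..int N + 2}. d i * d j * exp (x i * x j)) \<le> 1 / 40"
        using mult_left_mono[OF xd(7), of "real n"] chi by linarith
      show "(\<Sum>i\<in>{-int N..int N + 2} - {0}. max (- d i) 0) \<le> \<epsilon>"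
        using xd(6) small(2) \<epsilon> by (auto split: if_splits)
    qed (use xd small \<epsilon> in auto)
    then show ?thesis using u h by (simp add: xd(2))
  qed
  show ?parametric
  proof -
    define s where "s = 1 / real n powr (1 / 4)"
    define u where "u = s / (64 * a)"
    have s: "0 < s" "s \<le> 1" using n by (auto simp: s_def ge_one_powr_ge_zero)
    have "(real n powr (1 / 4)) ^ 4 = real n" using n by (simp add: powr_power)
    then have sn: "real n * s ^ 4 = 1" using n by (simp add: s_def power_divide)
    have s2: "s\<^sup>2 \<le> 1" using s by (simp add: power_le_one)
    have au: "a * u\<^sup>2 = s\<^sup>2 / (4096 * a)" using a by (simp add: u_def power2_eq_square field_simps)
    have "s\<^sup>2 / (4096 * a) \<le> 1 / (4096 * a)" using s2 a by (intro divide_right_mono) auto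
    also have "\<dots> = \<epsilon>max / 16384" using \<epsilon>max by (simp add: a_def)
    finally have "32 * a * u\<^sup>2 \<le> \<epsilon>max / 2" using au \<epsilon>max by simp
    moreover have "real n * ((35 * a * u\<^sup>2)\<^sup>2 * exp (exp 2 * (1 * real (max 1 0))\<^sup>2 - 2 * max 2 (2 * real 0 + 1))) \<le> 1 / 40"
    proof -
      have "real n * (35 * a * u\<^sup>2)\<^sup>2 = real n * (35 * (a * u\<^sup>2))\<^sup>2" by (simp add: mult.assoc)
      also have "\<dots> = (real n * s ^ 4) * (35 / (4096 * a))\<^sup>2"
        unfolding au by (simp add: power_divide power_mult_distrib)
      also have "\<dots> = (35 / (4096 * a))\<^sup>2" by (simp add: sn)
      also have "\<dots> \<le> (35 / (4096 * 8))\<^sup>2" using a by (intro power_mono divide_left_mono) auto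
      finally have 1: "real n * (35 * a * u\<^sup>2)\<^sup>2 \<le> (35 / (4096 * 8))\<^sup>2" .
      have "exp (exp 2 - 4) \<le> exp (5 * 1 :: real)" using exp2 by simp
      also have "\<dots> = exp 1 ^ 5" by (subst exp_of_nat_mult[of 5 1, symmetric]) simp
      also have "\<dots> \<le> 3 ^ 5" using exp_le by (intro power_mono) auto
      finally have 2: "exp (exp 2 - 4) \<le> (243 :: real)" by simp
      have "real n * ((35 * a * u\<^sup>2)\<^sup>2 * exp (exp 2 * (1 * real (max 1 0))\<^sup>2 - 2 * max 2 (2 * real 0 + 1)))
          = real n * (35 * a * u\<^sup>2)\<^sup>2 * exp (exp 2 - 4)" by simp
      also have "\<dots> \<le> (35 / (4096 * 8))\<^sup>2 * 243" by (intro mult_mono 1 2) auto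
      also have "\<dots> \<le> 1 / 40" by (simp add: power2_eq_square)
      finally show ?thesis .
    qed
    ultimately have "\<sigma> * (1 * u) \<le> r \<epsilon>"
      using s a by (intro bound[where N=0]) (auto simp: u_def)
    then show ?thesis by (simp add: u_def s_def mult.commute mult.left_commute)
  qed
  show ?contaminated if big: "1 \<le> real n * \<epsilon>\<^sup>2"
  proof -
    define \<Lambda> where "\<Lambda> = ln (real n * \<epsilon>\<^sup>2)"
    define N where "N = 1 + nat \<lfloor>\<Lambda> / 2\<rfloor>"
    define u where "u = sqrt (\<epsilon> / (400 * a))"
    \<comment> \<open>The nodes have radius \<open>h N = \<surd>N / 3\<close>, and \<open>exp 2 * (\<surd>N / 3)\<^sup>2 \<le> N\<close>.\<close>
    define h where "h = 1 / (3 * sqrt (real N))"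
    have \<epsilon>0: "0 < \<epsilon>" using big \<epsilon> by (cases "\<epsilon> = 0") auto
    have "0 \<le> \<Lambda>" using big by (simp add: \<Lambda>_def)
    have eN: "real N = 1 + of_int \<lfloor>\<Lambda> / 2\<rfloor>" using \<open>0 \<le> \<Lambda>\<close> by (simp add: N_def)
    then have N: "\<Lambda> \<le> 2 * real N" "real N \<le> 1 + \<Lambda>" "1 \<le> N" using \<open>0 \<le> \<Lambda>\<close> by (linarith, linarith, simp add: N_def)
    have L: "max 1 (ln (exp 1 * real n * \<epsilon>\<^sup>2)) = 1 + \<Lambda>"
      using \<open>0 \<le> \<Lambda>\<close> \<epsilon>0 n by (simp add: \<Lambda>_def ln_mult mult.assoc)
    have u2: "u\<^sup>2 = \<epsilon> / (400 * a)" using \<epsilon>0 a by (simp add: u_def)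
    have au: "a * u\<^sup>2 = \<epsilon> / 400" using a unfolding u2 by simp
    have "(a * u)\<^sup>2 = a * (a * u\<^sup>2)" by (simp add: power2_eq_square)
    also have "\<dots> = a * \<epsilon> / 400" unfolding au by simp
    also have "\<dots> \<le> a * \<epsilon>max / 400"
      using \<epsilon> a by (intro divide_right_mono mult_left_mono) auto
    also have "\<dots> \<le> (1 / 2)\<^sup>2" using a by (simp add: power2_eq_square)
    finally have au2: "a * u \<le> 1 / 2" by (rule power2_le_imp_le) simp
    have M: "(h * real (max 1 N))\<^sup>2 = real N / 9"
      using N(3) by (simp add: h_def power_mult_distrib power_divide power2_eq_square max_def)
    have "real n * ((35 * a * u\<^sup>2)\<^sup>2 * exp (exp 2 * (h * real (max 1 N))\<^sup>2 - 2 * max 2 (2 * real N + 1))) \<le> 1 / 40"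
    proof -
      have "exp 2 * (real N / 9) \<le> 9 * (real N / 9)" using exp2 by (intro mult_right_mono) auto
      moreover have "2 * real N + 1 \<le> max 2 (2 * real N + 1)" by simp
      ultimately have "exp 2 * (real N / 9) - 2 * max 2 (2 * real N + 1) \<le> - \<Lambda>"
        using N(1) of_nat_0_le_iff[of N, where ?'a=real] unfolding times_divide_eq_right by argo
      then have "exp (exp 2 * (real N / 9) - 2 * max 2 (2 * real N + 1)) \<le> exp (- \<Lambda>)" by simp
      also have "\<dots> = 1 / (real n * \<epsilon>\<^sup>2)" using \<epsilon>0 n by (simp add: \<Lambda>_def exp_minus inverse_eq_divide)
      finally have 1: "exp (exp 2 * (real N / 9) - 2 * max 2 (2 * real N + 1)) \<le> 1 / (real n * \<epsilon>\<^sup>2)" .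
      have "real n * (35 * a * u\<^sup>2)\<^sup>2 = real n * (35 * (a * u\<^sup>2))\<^sup>2" by (simp add: mult.assoc)
      also have "\<dots> = real n * \<epsilon>\<^sup>2 * (49 / 6400)" unfolding au by (simp add: power2_eq_square)
      finally have 2: "real n * (35 * a * u\<^sup>2)\<^sup>2 = real n * \<epsilon>\<^sup>2 * (49 / 6400)" .
      have "real n * (35 * a * u\<^sup>2)\<^sup>2 * exp (exp 2 * (real N / 9) - 2 * max 2 (2 * real N + 1))
          \<le> real n * \<epsilon>\<^sup>2 * (49 / 6400) * (1 / (real n * \<epsilon>\<^sup>2))"
        unfolding 2 using 1 by (intro mult_left_mono) auto
      also have "\<dots> = 49 / 6400" using \<epsilon>0 n by simp
      finally show ?thesis unfolding M mult.assoc[symmetric] by simp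
    qed
    then have "\<sigma> * (h * u) \<le> r \<epsilon>"
      using \<epsilon>0 a au au2 N \<epsilon> by (intro bound[where N=N]) (auto simp: u_def h_def)
    moreover have "1 / (64 * a) * (sqrt \<epsilon> / sqrt (1 + \<Lambda>)) \<le> h * u"
    proof -
      have "sqrt a \<le> sqrt (a * a)" using a by (intro real_sqrt_le_mono) auto
      then have "60 * (sqrt a * sqrt (real N)) \<le> 64 * (a * sqrt (1 + \<Lambda>))"
        using a N by (intro mult_mono) auto
      then have "sqrt \<epsilon> / (64 * (a * sqrt (1 + \<Lambda>))) \<le> sqrt \<epsilon> / (60 * (sqrt a * sqrt (real N)))"
        using \<epsilon>0 a N by (intro divide_left_mono) auto
      also have "\<dots> = h * u"
      proof -
        have "sqrt 400 = (20 :: real)" by (rule real_sqrt_unique) auto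
        then show ?thesis by (simp add: h_def u_def real_sqrt_divide real_sqrt_mult)
      qed
      finally show ?thesis by (simp add: mult.assoc)
    qed
    then have "\<sigma> * (1 / (64 * a) * (sqrt \<epsilon> / sqrt (1 + \<Lambda>))) \<le> \<sigma> * (h * u)"
      using \<sigma> by (intro mult_left_mono) auto
    ultimately show ?thesis unfolding L by simp
  qed
qed

theorem theorem3:
  fixes \<delta> \<epsilon>max :: real
  assumes "0 < \<delta>" "\<delta> < 1 / 4" "0 < \<epsilon>max" "\<epsilon>max < 1 / 2"
  shows "\<exists>c > 0. \<forall>(CI :: nat \<Rightarrow> real \<Rightarrow> (nat \<Rightarrow> real) \<Rightarrow> real set) (r :: nat \<Rightarrow> real \<Rightarrow> real \<Rightarrow> real).
    \<forall>n \<ge> 1. \<forall>\<sigma> > 0.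
      confidence_interval n (CI n \<sigma>) \<longrightarrow>
      (INF \<theta>. INF (\<epsilon>, Q)\<in>{0..\<epsilon>max} \<times> space (prob_algebra borel).
         \<P>(x in two_groups_iid n \<theta> \<sigma> \<epsilon> Q. \<theta> \<in> CI n \<sigma> x)) \<ge> 1 - \<delta> \<longrightarrow>
      (INF \<theta>. INF (\<epsilon>, Q)\<in>{0..\<epsilon>max} \<times> space (prob_algebra borel).
         \<P>(x in two_groups_iid n \<theta> \<sigma> \<epsilon> Q. set_length (CI n \<sigma> x) \<le> ereal (r n \<sigma> \<epsilon>))) \<ge> 1 - \<delta> \<longrightarrow>
      (\<forall>\<epsilon>\<in>{0..\<epsilon>max}.
         r n \<sigma> \<epsilon> \<ge> c * \<sigma> * (1 / real n powr (1 / 4)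
           + sqrt \<epsilon> / sqrt (max 1 (ln (exp 1 * real n * \<epsilon>\<^sup>2)))))"
proof -
  define a where "a = 4 / \<epsilon>max"
  have a: "0 < a" using assms by (simp add: a_def)
  show ?thesis
  proof (intro exI[of _ "1 / (128 * a)"] conjI allI impI ballI)
    show "0 < 1 / (128 * a)" using a by simp
    fix CI :: "nat \<Rightarrow> real \<Rightarrow> (nat \<Rightarrow> real) \<Rightarrow> real set" and r :: "nat \<Rightarrow> real \<Rightarrow> real \<Rightarrow> real"
      and n :: nat and \<sigma> \<epsilon> :: real
    assume n: "1 \<le> n" and \<sigma>: "0 < \<sigma>" and CI: "confidence_interval n (CI n \<sigma>)"
      and cov: "(INF \<theta>. INF (\<epsilon>, Q)\<in>{0..\<epsilon>max} \<times> space (prob_algebra borel).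
         \<P>(x in two_groups_iid n \<theta> \<sigma> \<epsilon> Q. \<theta> \<in> CI n \<sigma> x)) \<ge> 1 - \<delta>"
      and len: "(INF \<theta>. INF (\<epsilon>, Q)\<in>{0..\<epsilon>max} \<times> space (prob_algebra borel).
         \<P>(x in two_groups_iid n \<theta> \<sigma> \<epsilon> Q. set_length (CI n \<sigma> x) \<le> ereal (r n \<sigma> \<epsilon>))) \<ge> 1 - \<delta>"
      and \<epsilon>: "\<epsilon> \<in> {0..\<epsilon>max}"
    let ?A = "1 / real n powr (1 / 4)"
    let ?B = "sqrt \<epsilon> / sqrt (max 1 (ln (exp 1 * real n * \<epsilon>\<^sup>2)))"
    note bounds = adaptive_length_bound[OF CI assms(2,3,4) \<sigma> n
        cINF_ge_imp_all[OF cov measure_nonneg] cINF_ge_imp_all[OF len measure_nonneg] \<epsilon>, folded a_def]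
    \<comment> \<open>For \<open>n \<epsilon>\<^sup>2 < 1\<close> the contamination term is dominated by \<open>n\<^sup>-\<^sup>1\<^sup>/\<^sup>4\<close>.\<close>
    have second: "\<sigma> / (64 * a) * ?B \<le> r n \<sigma> \<epsilon>"
    proof (cases "1 \<le> real n * \<epsilon>\<^sup>2")
      case True
      then show ?thesis by (rule bounds(2))
    next
      case False
      have "?B \<le> sqrt \<epsilon> / 1" using \<epsilon> by (intro divide_left_mono) auto
      also have "\<dots> \<le> ?A"
      proof -
        have "\<epsilon>\<^sup>2 \<le> 1 / real n" using False n by (simp add: field_simps)
        then have "\<epsilon> \<le> sqrt (1 / real n)" by (rule real_le_rsqrt)
        then have "sqrt \<epsilon> \<le> sqrt (sqrt (1 / real n))" by simp
        also have "\<dots> = ?A"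
          using n by (simp add: powr_half_sqrt[symmetric] powr_powr powr_divide)
        finally show ?thesis by simp
      qed
      finally have "\<sigma> / (64 * a) * ?B \<le> \<sigma> / (64 * a) * ?A" using \<sigma> a by (intro mult_left_mono) auto
      then show ?thesis using bounds(1) by linarith
    qed
    have halves: "1 / (128 * a) * \<sigma> * (A + B) = (\<sigma> / (64 * a) * A + \<sigma> / (64 * a) * B) / 2" for A B
      using a by (simp add: field_simps)
    show "1 / (128 * a) * \<sigma> * (?A + ?B) \<le> r n \<sigma> \<epsilon>"
    proof -
      have "(A + B) / 2 \<le> C" if "A \<le> C" "B \<le> C" for A B C :: real using that by simp
      from this[OF bounds(1) second] show ?thesis unfolding halves .
    qed
  qed
qed

end
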